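(* Let $M$ be a compact orientable manifold with a chosen oriented atlas, let $\delta\in\mathbb R$, and let $\mathbf S=S^{ab}(x)|D(x)|^\delta\,\partial_a\otimes\partial_b$ be an arbitrary contravariant symmetric tensor density of weight $\delta$ on $M$. Then $\mathbf S$ defines the groupoid of connections $C_{\mathbf S}$ and a family of second order differential operators of weight $\delta$ acting on densities of weight $\frac{1-\delta}{2}$, $$\Delta([\gamma])=\Delta_{\rm sing}(\mathbf S,\gamma)\colon\ \mathcal F_{\frac{1-\delta}{2}}(M)\to\mathcal F_{\frac{1+\delta}{2}}(M).$$ All operators in this family have the same principal symbol $\mathbf S$, and they depend only on the equivalence classes $[\gamma]$ of connections on volume forms that are the orbits of the groupoid $C_{\mathbf S}$.
   Context: $\mathcal F_\lambda(M)$ is the space of densities $s(x)|D(x)|^\lambda$ of weight $\lambda$ on $M$, where $s(x)|D(x)|^\lambda=s(x(x'))\left|\det\frac{\partial x}{\partial x'}\right|^\lambda|D(x')|^\lambda$. The components of a tensor density of weight $\delta$ transform as $S^{a'b'}=J^{-\delta}\frac{\partial x^{a'}}{\partial x^a}\frac{\partial x^{b'}}{\partial x^b}S^{ab}$, with $J=\det(\partial x'/\partial x)$. A connection on volume forms is given in coordinates by $\nabla_a(\rho|D(x)|)=(\partial_a\rho+\gamma_a\rho)|D(x)|$, and is identified with the collection $\gamma=\{\gamma_a\}$. It transforms by $\gamma_a=\frac{\partial x^{a'}}{\partial x^a}\bigl(\gamma_{a'}+\partial_{a'}\log|\det\frac{\partial x}{\partial x'}|\bigr)$. The difference of two connections is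 a covector field. For $\mathbf S$ and a connection $\gamma$, put $\gamma^a=S^{ab}\gamma_b$ and define in local coordinates the operator $\Delta_{\rm sing}(\mathbf S,\gamma)\colon\mathcal F_{\frac{1-\delta}2}\to\mathcal F_{\frac{1+\delta}2}$ by $$\Delta_{\rm sing}(\mathbf S,\gamma)=\frac{|D(x)|^\delta}{2}\Bigl(S^{ab}\partial_a\partial_b+(\partial_bS^{ba})\partial_a+\frac{1-\delta}{2}\bigl(\partial_a\gamma^a+\frac{\delta-1}{2}\gamma_a\gamma^a\bigr)\Bigr)$$ (the operator acts on the coefficient $s(x)$ of $s(x)|D(x)|^{(1-\delta)/2}$). Operators of the form $\frac{|D(x)|^\delta}{2}(S^{ab}\partial_a\partial_b+\dots)$ are said to have principal symbol $\mathbf S$. The groupoid of connections $C_{\mathbf S}$ has as objects all connections on volume forms on $M$. Its arrows $\gamma\xrightarrow{\mathbf X}\gamma'$, with $\mathbf X=\gamma'-\gamma$ a covector field, are those for which $\Delta_{\rm sing}(\mathbf S,\gamma')=\Delta_{\rm sing}(\mathbf S,\gamma)$. The composition of $\gamma_1\xrightarrow{\mathbf X}\gamma_2$ and $\gamma_2\xrightarrow{\mathbf Y}\gamma_3$ is $\gamma_1\xrightarrow{\mathbf X+\mathbf Y}\gamma_3$, and the inverse of $\gamma\xrightarrow{\mathbf X}\gamma'$ is $\gamma'\xrightarrow{-\mathbf X}\gamma$. The orbit of $\gamma$ is $[\gamma]=\{\gamma' : (\gamma\to\gamma')\in C_{\mathbf S}\}$. *)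

theory Defs
  imports "HOL-Analysis.Analysis"
begin

section \<open>Smooth functions and partial derivatives\<close>

text \<open>For open \<open>U\<close>, the predicate \<open>differentiable_upto k U f\<close> says that all iterated directional
  derivatives of \<open>f\<close> of order less than \<open>k\<close> exist and are (Frechet) differentiable on \<open>U\<close>; for all
  \<open>k\<close> together this is the class of infinitely differentiable functions.  Only the values of \<open>f\<close>
  on the open set \<open>U\<close> matter.\<close>

primrec differentiable_upto ::
  "nat \<Rightarrow> 'u::real_normed_vector set \<Rightarrow> ('u \<Rightarrow> 'v::real_normed_vector) \<Rightarrow> bool" where
  "differentiable_upto 0 U f \<longleftrightarrow> True"
| "differentiable_upto (Suc k) U f \<longleftrightarrow>
     (\<forall>x\<in>U. f differentiable (at x)) \<and>
     (\<forall>v. differentiable_upto k U (\<lambda>x. frechet_derivative f (at x) v))"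

definition smooth_on ::
  "'u::real_normed_vector set \<Rightarrow> ('u \<Rightarrow> 'v::real_normed_vector) \<Rightarrow> bool" where
  "smooth_on U f \<longleftrightarrow> (\<forall>k. differentiable_upto k U f)"

definition partial :: "'n::finite \<Rightarrow> (real^'n \<Rightarrow> real) \<Rightarrow> real^'n \<Rightarrow> real" where
  "partial a f x = frechet_derivative f (at x) (axis a 1)"

text \<open>\<open>jacobian f x $ i $ j\<close> is the derivative of the \<open>i\<close>-th component of \<open>f\<close> in the \<open>j\<close>-th
  coordinate direction.\<close>

definition jacobian :: "(real^'n \<Rightarrow> real^'n) \<Rightarrow> real^'n \<Rightarrow> real^'n^'n" where
  "jacobian f x = matrix (frechet_derivative f (at x))"


section \<open>Manifolds with an oriented atlas\<close>

text \<open>A chart is a pair of its domain in \<open>M\<close> and its coordinate map; the values of the coordinate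
  map outside the domain are irrelevant.\<close>

type_synonym ('a, 'n) chart = "'a set \<times> ('a \<Rightarrow> real^'n)"

definition chart_image :: "('a, 'n::finite) chart \<Rightarrow> (real^'n) set" where
  "chart_image c = snd c ` fst c"

definition chart_overlap :: "('a, 'n::finite) chart \<Rightarrow> ('a, 'n) chart \<Rightarrow> (real^'n) set" where
  "chart_overlap c c' = snd c ` (fst c \<inter> fst c')"

text \<open>The change of coordinates expressing the coordinates of \<open>c'\<close> through those of \<open>c\<close>; it is
  meaningful on \<open>chart_overlap c c'\<close>.\<close>

definition transition ::
  "('a, 'n::finite) chart \<Rightarrow> ('a, 'n) chart \<Rightarrow> real^'n \<Rightarrow> real^'n" where
  "transition c c' x = snd c' (inv_into (fst c) (snd c) x)"

definition is_chart :: "'a topology \<Rightarrow> ('a, 'n::finite) chart \<Rightarrow> bool" where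
  "is_chart M c \<longleftrightarrow>
     openin M (fst c) \<and> open (chart_image c) \<and>
     homeomorphic_map (subtopology M (fst c)) (top_of_set (chart_image c)) (snd c)"

definition smooth_manifold :: "'a topology \<Rightarrow> ('a, 'n::finite) chart set \<Rightarrow> bool" where
  "smooth_manifold M A \<longleftrightarrow>
     Hausdorff_space M \<and> second_countable M \<and>
     (\<forall>c\<in>A. is_chart M c) \<and> (\<Union>c\<in>A. fst c) = topspace M \<and>
     (\<forall>c\<in>A. \<forall>c'\<in>A. smooth_on (chart_overlap c c') (transition c c'))"

definition oriented_atlas :: "('a, 'n::finite) chart set \<Rightarrow> bool" where
  "oriented_atlas A \<longleftrightarrow>
     (\<forall>c\<in>A. \<forall>c'\<in>A. \<forall>x\<in>chart_overlap c c'. det (jacobian (transition c c') x) > 0)"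


section \<open>Geometric objects on a manifold\<close>

text \<open>Densities, tensor densities, covector fields and connections are families of coordinate
  components, one for each chart of the atlas, related by the transformation law.  The components
  are required to vanish outside the chart image and for charts outside the atlas, so that equality
  of geometric objects is equality of the families.\<close>

definition supported_on_charts ::
  "('a, 'n::finite) chart set \<Rightarrow> (('a, 'n) chart \<Rightarrow> real^'n \<Rightarrow> 'v::zero) \<Rightarrow> bool" where
  "supported_on_charts A F \<longleftrightarrow> (\<forall>c x. \<not> (c \<in> A \<and> x \<in> chart_image c) \<longrightarrow> F c x = 0)"

definition densities ::
  "('a, 'n::finite) chart set \<Rightarrow> real \<Rightarrow> (('a, 'n) chart \<Rightarrow> real^'n \<Rightarrow> real) set" where
  "densities A w = {s.
     supported_on_charts A s \<and>
     (\<forall>c\<in>A. smooth_on (chart_image c) (s c)) \<and>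
     (\<forall>c\<in>A. \<forall>c'\<in>A. \<forall>x'\<in>chart_overlap c' c.
        s c' x' = s c (transition c' c x') * \<bar>det (jacobian (transition c' c) x')\<bar> powr w)}"

definition symmetric_tensor_densities ::
  "('a, 'n::finite) chart set \<Rightarrow> real \<Rightarrow> (('a, 'n) chart \<Rightarrow> real^'n \<Rightarrow> real^'n^'n) set" where
  "symmetric_tensor_densities A \<delta> = {S.
     supported_on_charts A S \<and>
     (\<forall>c\<in>A. smooth_on (chart_image c) (S c)) \<and>
     (\<forall>c\<in>A. \<forall>x\<in>chart_image c. \<forall>a b. S c x $ a $ b = S c x $ b $ a) \<and>
     (\<forall>c\<in>A. \<forall>c'\<in>A. \<forall>x\<in>chart_overlap c c'. \<forall>a' b'.
        S c' (transition c c' x) $ a' $ b' =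
          det (jacobian (transition c c') x) powr (- \<delta>) *
          (\<Sum>a\<in>UNIV. \<Sum>b\<in>UNIV.
             jacobian (transition c c') x $ a' $ a * jacobian (transition c c') x $ b' $ b *
             S c x $ a $ b))}"

definition covector_fields ::
  "('a, 'n::finite) chart set \<Rightarrow> (('a, 'n) chart \<Rightarrow> real^'n \<Rightarrow> real^'n) set" where
  "covector_fields A = {X.
     supported_on_charts A X \<and>
     (\<forall>c\<in>A. smooth_on (chart_image c) (X c)) \<and>
     (\<forall>c\<in>A. \<forall>c'\<in>A. \<forall>x\<in>chart_overlap c c'. \<forall>a.
        X c x $ a =
          (\<Sum>a'\<in>UNIV. jacobian (transition c c') x $ a' $ a * X c' (transition c c' x) $ a'))}"

text \<open>Connections on volume forms, given by the coefficients \<open>\<gamma>\<^sub>a\<close> in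
  \<open>\<nabla>\<^sub>a (\<rho> |D(x)|) = (\<partial>\<^sub>a \<rho> + \<gamma>\<^sub>a \<rho>) |D(x)|\<close>.\<close>

definition connections ::
  "('a, 'n::finite) chart set \<Rightarrow> (('a, 'n) chart \<Rightarrow> real^'n \<Rightarrow> real^'n) set" where
  "connections A = {\<gamma>.
     supported_on_charts A \<gamma> \<and>
     (\<forall>c\<in>A. smooth_on (chart_image c) (\<gamma> c)) \<and>
     (\<forall>c\<in>A. \<forall>c'\<in>A. \<forall>x\<in>chart_overlap c c'. \<forall>a.
        \<gamma> c x $ a =
          (\<Sum>a'\<in>UNIV. jacobian (transition c c') x $ a' $ a *
             (\<gamma> c' (transition c c' x) $ a' +
              partial a' (\<lambda>x'. ln \<bar>det (jacobian (transition c' c) x')\<bar>) (transition c c' x))))}"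


section \<open>Second order operators on densities\<close>

text \<open>\<open>operator_form A w c P T R L\<close>: in the coordinates of \<open>c\<close>, the operator \<open>L\<close> on densities of
  weight \<open>w\<close> is \<open>1/2 (P\<^sup>a\<^sup>b \<partial>\<^sub>a \<partial>\<^sub>b + T\<^sup>a \<partial>\<^sub>a + R)\<close>, acting on coefficients.\<close>

definition operator_form ::
  "('a, 'n::finite) chart set \<Rightarrow> real \<Rightarrow> ('a, 'n) chart \<Rightarrow>
   (real^'n \<Rightarrow> real^'n^'n) \<Rightarrow> (real^'n \<Rightarrow> real^'n) \<Rightarrow> (real^'n \<Rightarrow> real) \<Rightarrow>
   ((('a, 'n) chart \<Rightarrow> real^'n \<Rightarrow> real) \<Rightarrow> ('a, 'n) chart \<Rightarrow> real^'n \<Rightarrow> real) \<Rightarrow> bool" where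
  "operator_form A w c P T R L \<longleftrightarrow>
     (\<forall>s\<in>densities A w. \<forall>x\<in>chart_image c.
        L s c x = 1/2 *
          ((\<Sum>a\<in>UNIV. \<Sum>b\<in>UNIV. P x $ a $ b * partial a (partial b (s c)) x)
           + (\<Sum>a\<in>UNIV. T x $ a * partial a (s c) x)
           + R x * s c x))"

text \<open>Operators of order at most two from densities of weight \<open>w\<close> to densities of weight
  \<open>w + \<delta>\<close>.  They are extensional functions, so equality means equality on all densities of
  weight \<open>w\<close>.\<close>

definition second_order_operators ::
  "('a, 'n::finite) chart set \<Rightarrow> real \<Rightarrow> real \<Rightarrow>
   ((('a, 'n) chart \<Rightarrow> real^'n \<Rightarrow> real) \<Rightarrow> ('a, 'n) chart \<Rightarrow> real^'n \<Rightarrow> real) set" where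
  "second_order_operators A w \<delta> = {L.
     L \<in> densities A w \<rightarrow>\<^sub>E densities A (w + \<delta>) \<and>
     (\<forall>c\<in>A. \<exists>P T R. smooth_on (chart_image c) P \<and> smooth_on (chart_image c) T \<and>
        smooth_on (chart_image c) R \<and> operator_form A w c P T R L)}"

definition has_principal_symbol ::
  "('a, 'n::finite) chart set \<Rightarrow> real \<Rightarrow>
   ((('a, 'n) chart \<Rightarrow> real^'n \<Rightarrow> real) \<Rightarrow> ('a, 'n) chart \<Rightarrow> real^'n \<Rightarrow> real) \<Rightarrow>
   (('a, 'n) chart \<Rightarrow> real^'n \<Rightarrow> real^'n^'n) \<Rightarrow> bool" where
  "has_principal_symbol A w L S \<longleftrightarrow>
     (\<forall>c\<in>A. \<exists>T R. smooth_on (chart_image c) T \<and> smooth_on (chart_image c) R \<and>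
        operator_form A w c (S c) T R L)"

definition raise_index ::
  "(('a, 'n::finite) chart \<Rightarrow> real^'n \<Rightarrow> real^'n^'n) \<Rightarrow> (('a, 'n) chart \<Rightarrow> real^'n \<Rightarrow> real^'n) \<Rightarrow>
   ('a, 'n) chart \<Rightarrow> real^'n \<Rightarrow> real^'n" where
  "raise_index S \<gamma> c x = (\<chi> a. \<Sum>b\<in>UNIV. S c x $ a $ b * \<gamma> c x $ b)"

definition Delta_sing ::
  "('a, 'n::finite) chart set \<Rightarrow> real \<Rightarrow> (('a, 'n) chart \<Rightarrow> real^'n \<Rightarrow> real^'n^'n) \<Rightarrow>
   (('a, 'n) chart \<Rightarrow> real^'n \<Rightarrow> real^'n) \<Rightarrow>
   (('a, 'n) chart \<Rightarrow> real^'n \<Rightarrow> real) \<Rightarrow> ('a, 'n) chart \<Rightarrow> real^'n \<Rightarrow> real" where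
  "Delta_sing A \<delta> S \<gamma> = (\<lambda>s\<in>densities A ((1 - \<delta>) / 2). \<lambda>c x.
     if c \<in> A \<and> x \<in> chart_image c then
       1/2 *
         ((\<Sum>a\<in>UNIV. \<Sum>b\<in>UNIV. S c x $ a $ b * partial a (partial b (s c)) x)
          + (\<Sum>a\<in>UNIV. (\<Sum>b\<in>UNIV. partial b (\<lambda>y. S c y $ b $ a) x) * partial a (s c) x)
          + (1 - \<delta>) / 2 *
              ((\<Sum>a\<in>UNIV. partial a (\<lambda>y. raise_index S \<gamma> c y $ a) x)
               + (\<delta> - 1) / 2 * (\<Sum>a\<in>UNIV. \<gamma> c x $ a * raise_index S \<gamma> c x $ a)) * s c x)
     else 0)"


section \<open>The groupoid of connections\<close>

text \<open>Small categories in which every arrow is invertible.  \<open>cmp f g\<close> is the composite of \<open>f\<close>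
  followed by \<open>g\<close>.\<close>

locale groupoid =
  fixes Obj :: "'o set" and Arr :: "'m set"
    and src :: "'m \<Rightarrow> 'o" and tgt :: "'m \<Rightarrow> 'o"
    and cmp :: "'m \<Rightarrow> 'm \<Rightarrow> 'm" and ident :: "'o \<Rightarrow> 'm" and invr :: "'m \<Rightarrow> 'm"
  assumes src_in: "f \<in> Arr \<Longrightarrow> src f \<in> Obj"
    and tgt_in: "f \<in> Arr \<Longrightarrow> tgt f \<in> Obj"
    and cmp_in: "f \<in> Arr \<Longrightarrow> g \<in> Arr \<Longrightarrow> tgt f = src g \<Longrightarrow>
      cmp f g \<in> Arr \<and> src (cmp f g) = src f \<and> tgt (cmp f g) = tgt g"
    and cmp_assoc: "f \<in> Arr \<Longrightarrow> g \<in> Arr \<Longrightarrow> h \<in> Arr \<Longrightarrow> tgt f = src g \<Longrightarrow> tgt g = src h \<Longrightarrow>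
      cmp (cmp f g) h = cmp f (cmp g h)"
    and ident_in: "x \<in> Obj \<Longrightarrow> ident x \<in> Arr \<and> src (ident x) = x \<and> tgt (ident x) = x"
    and ident_left: "f \<in> Arr \<Longrightarrow> cmp (ident (src f)) f = f"
    and ident_right: "f \<in> Arr \<Longrightarrow> cmp f (ident (tgt f)) = f"
    and invr_in: "f \<in> Arr \<Longrightarrow> invr f \<in> Arr \<and> src (invr f) = tgt f \<and> tgt (invr f) = src f"
    and invr_right: "f \<in> Arr \<Longrightarrow> cmp f (invr f) = ident (src f)"
    and invr_left: "f \<in> Arr \<Longrightarrow> cmp (invr f) f = ident (tgt f)"

text \<open>An arrow from \<open>\<gamma>\<close> to \<open>\<gamma>'\<close> labelled by \<open>X\<close> is the triple \<open>(\<gamma>, X, \<gamma>')\<close>.\<close>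

type_synonym ('a, 'n) covector_family = "('a, 'n) chart \<Rightarrow> real^'n \<Rightarrow> real^'n"

type_synonym ('a, 'n) connection_arrow =
  "('a, 'n) covector_family \<times> ('a, 'n) covector_family \<times> ('a, 'n) covector_family"

definition connection_arrows ::
  "('a, 'n::finite) chart set \<Rightarrow> real \<Rightarrow> (('a, 'n) chart \<Rightarrow> real^'n \<Rightarrow> real^'n^'n) \<Rightarrow>
   ('a, 'n) connection_arrow set" where
  "connection_arrows A \<delta> S = {(\<gamma>, X, \<gamma>').
     \<gamma> \<in> connections A \<and> \<gamma>' \<in> connections A \<and> X = (\<lambda>c x. \<gamma>' c x - \<gamma> c x) \<and>
     Delta_sing A \<delta> S \<gamma>' = Delta_sing A \<delta> S \<gamma>}"

definition arrow_source :: "('a, 'n::finite) connection_arrow \<Rightarrow> ('a, 'n) covector_family" where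
  "arrow_source = (\<lambda>(\<gamma>, X, \<gamma>'). \<gamma>)"

definition arrow_target :: "('a, 'n::finite) connection_arrow \<Rightarrow> ('a, 'n) covector_family" where
  "arrow_target = (\<lambda>(\<gamma>, X, \<gamma>'). \<gamma>')"

definition arrow_comp ::
  "('a, 'n::finite) connection_arrow \<Rightarrow> ('a, 'n) connection_arrow \<Rightarrow> ('a, 'n) connection_arrow" where
  "arrow_comp = (\<lambda>(\<gamma>\<^sub>1, X, \<gamma>\<^sub>2) (\<gamma>\<^sub>2', Y, \<gamma>\<^sub>3). (\<gamma>\<^sub>1, (\<lambda>c x. X c x + Y c x), \<gamma>\<^sub>3))"

definition arrow_ident :: "('a, 'n::finite) covector_family \<Rightarrow> ('a, 'n) connection_arrow" where
  "arrow_ident \<gamma> = (\<gamma>, (\<lambda>c x. 0), \<gamma>)"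

definition arrow_inverse :: "('a, 'n::finite) connection_arrow \<Rightarrow> ('a, 'n) connection_arrow" where
  "arrow_inverse = (\<lambda>(\<gamma>, X, \<gamma>'). (\<gamma>', (\<lambda>c x. - X c x), \<gamma>))"

definition connection_orbit ::
  "('a, 'n::finite) chart set \<Rightarrow> real \<Rightarrow> (('a, 'n) chart \<Rightarrow> real^'n \<Rightarrow> real^'n^'n) \<Rightarrow>
   ('a, 'n) covector_family \<Rightarrow> ('a, 'n) covector_family set" where
  "connection_orbit A \<delta> S \<gamma> = {\<gamma>'. \<exists>X. (\<gamma>, X, \<gamma>') \<in> connection_arrows A \<delta> S}"

text \<open>The operator attached to an orbit: the common value of \<open>Delta_sing\<close> on its members.\<close>

definition Delta_orbit ::
  "('a, 'n::finite) chart set \<Rightarrow> real \<Rightarrow> (('a, 'n) chart \<Rightarrow> real^'n \<Rightarrow> real^'n^'n) \<Rightarrow>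
   ('a, 'n) covector_family set \<Rightarrow>
   (('a, 'n) chart \<Rightarrow> real^'n \<Rightarrow> real) \<Rightarrow> ('a, 'n) chart \<Rightarrow> real^'n \<Rightarrow> real" where
  "Delta_orbit A \<delta> S \<Gamma> = (THE L. \<forall>\<gamma>\<in>\<Gamma>. Delta_sing A \<delta> S \<gamma> = L)"

end

theory Submission
  imports Defs
begin

text \<open>Put \<open>w = (1 - \<delta>) / 2\<close>.  The operator is \<open>1/2 (\<partial>\<^sub>a - w \<gamma>\<^sub>a) (S\<^sup>a\<^sup>b (\<partial>\<^sub>b + w \<gamma>\<^sub>b) s)\<close>: the covariant
  gradient of a density of weight \<open>w\<close>, raised by \<open>S\<close> to a vector density of weight
  \<open>w + \<delta> = 1 - w\<close>, followed by the covariant divergence of such a density.  Each of the three steps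
  commutes with changes of coordinates.  For the divergence this rests on Jacobi's formula for the
  derivative of \<open>log det (\<partial>x/\<partial>x')\<close> and on the symmetry of the second derivatives of the coordinate
  change.  Hence the local expressions define an operator between densities; the rest is formal,
  since arrows of the groupoid are by definition pairs of connections with equal operators.\<close>

section \<open>Calculus of smooth functions\<close>

text \<open>Openness of \<open>U\<close> makes derivatives at points of \<open>U\<close> depend only
  on the values on \<open>U\<close>. The closure lemmas below rely on this, since their derivative
  formulas hold on \<open>U\<close> only.\<close>

lemma differentiable_upto_cong:
  assumes "open U" "\<And>x. x \<in> U \<Longrightarrow> f x = g x" "differentiable_upto k U f"
  shows "differentiable_upto k U g"
  using assms(2,3)
proof (induction k arbitrary: f g)
  case (Suc k)
  have df: "f differentiable (at x)" if "x \<in> U" for x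
    using Suc.prems that by simp
  have dg: "g differentiable (at x)" if "x \<in> U" for x
    using df[OF that] has_derivative_transform_within_open[of f _ x UNIV U g] assms(1) that Suc.prems(1)
    unfolding differentiable_def by blast
  have "frechet_derivative f (at x) v = frechet_derivative g (at x) v" if "x \<in> U" for x v
    using frechet_derivative_transform_within_open[OF df[OF that] assms(1) that Suc.prems(1)] by simp
  then have "differentiable_upto k U (\<lambda>x. frechet_derivative g (at x) v)" for v
    using Suc.IH[of "\<lambda>x. frechet_derivative f (at x) v"] Suc.prems(2) by simp
  with dg show ?case by simp
qed simp

lemma differentiable_upto_Suc_imp: "differentiable_upto (Suc k) U f \<Longrightarrow> differentiable_upto k U f"
  by (induction k arbitrary: f) auto

lemma differentiable_upto_const: "differentiable_upto k U (\<lambda>x. c)"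
  by (induction k arbitrary: c) auto

lemma differentiable_upto_bounded_linear:
  assumes "open U" "bounded_linear h" "differentiable_upto k U f"
  shows "differentiable_upto k U (\<lambda>x. h (f x))"
  using assms(3)
proof (induction k arbitrary: f)
  case (Suc k)
  have der: "((\<lambda>x. h (f x)) has_derivative (\<lambda>v. h (frechet_derivative f (at x) v))) (at x)"
    if "x \<in> U" for x
    using Suc.prems that
    by (intro bounded_linear.has_derivative[OF assms(2)]) (auto simp flip: frechet_derivative_works)
  have "differentiable_upto k U (\<lambda>x. frechet_derivative (\<lambda>x. h (f x)) (at x) v)" for v
    by (rule differentiable_upto_cong[OF assms(1) _ Suc.IH[of "\<lambda>x. frechet_derivative f (at x) v"]])
      (use Suc.prems in \<open>auto simp flip: frechet_derivative_at[OF der]\<close>)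
  with der show ?case by (auto intro: differentiableI)
qed simp

lemma differentiable_upto_add:
  assumes "open U" "differentiable_upto k U f" "differentiable_upto k U g"
  shows "differentiable_upto k U (\<lambda>x. f x + g x)"
  using assms(2,3)
proof (induction k arbitrary: f g)
  case (Suc k)
  have der: "((\<lambda>x. f x + g x) has_derivative
      (\<lambda>v. frechet_derivative f (at x) v + frechet_derivative g (at x) v)) (at x)"
    if "x \<in> U" for x
    using Suc.prems that by (intro has_derivative_add) (auto simp flip: frechet_derivative_works)
  have "differentiable_upto k U (\<lambda>x. frechet_derivative (\<lambda>x. f x + g x) (at x) v)" for v
    by (rule differentiable_upto_cong[OF assms(1) _ Suc.IH[of
            "\<lambda>x. frechet_derivative f (at x) v" "\<lambda>x. frechet_derivative g (at x) v"]])
      (use Suc.prems in \<open>auto simp flip: frechet_derivative_at[OF der]\<close>)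
  with der show ?case by (auto intro: differentiableI)
qed simp

text \<open>Each summand of the product rule keeps one factor undifferentiated. That factor has
  order \<open>Suc k\<close>, the derivative of the other only order \<open>k\<close>;
  \<open>differentiable_upto_Suc_imp\<close> brings both to the order of the induction
  hypothesis.\<close>

lemma differentiable_upto_bilinear:
  assumes "open U" "bounded_bilinear h" "differentiable_upto k U f" "differentiable_upto k U g"
  shows "differentiable_upto k U (\<lambda>x. h (f x) (g x))"
  using assms(3,4)
proof (induction k arbitrary: f g)
  case (Suc k)
  have der: "((\<lambda>x. h (f x) (g x)) has_derivative
      (\<lambda>v. h (f x) (frechet_derivative g (at x) v) + h (frechet_derivative f (at x) v) (g x))) (at x)"
    if "x \<in> U" for x
    using Suc.prems that
    by (intro bounded_bilinear.FDERIV[OF assms(2)]) (auto simp flip: frechet_derivative_works)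
  have "differentiable_upto k U
      (\<lambda>x. h (f x) (frechet_derivative g (at x) v) + h (frechet_derivative f (at x) v) (g x))" for v
    using Suc.prems differentiable_upto_Suc_imp[of k U f] differentiable_upto_Suc_imp[of k U g]
    by (intro differentiable_upto_add[OF assms(1)] Suc.IH) auto
  then have "differentiable_upto k U (\<lambda>x. frechet_derivative (\<lambda>x. h (f x) (g x)) (at x) v)" for v
    by (rule differentiable_upto_cong[OF assms(1), rotated])
      (auto simp flip: frechet_derivative_at[OF der])
  with der show ?case by (auto intro: differentiableI)
qed simp

section \<open>Closure properties of smooth functions\<close>

lemma smooth_on_cong:
  assumes "open U" "smooth_on U f" "\<And>x. x \<in> U \<Longrightarrow> f x = g x"
  shows "smooth_on U g"
  using assms differentiable_upto_cong unfolding smooth_on_def by blast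

lemma smooth_on_const: "smooth_on U (\<lambda>x. c)"
  by (simp add: smooth_on_def differentiable_upto_const)

lemma smooth_on_bounded_linear:
  "open U \<Longrightarrow> bounded_linear h \<Longrightarrow> smooth_on U f \<Longrightarrow> smooth_on U (\<lambda>x. h (f x))"
  by (simp add: smooth_on_def differentiable_upto_bounded_linear)

lemma smooth_on_add:
  "open U \<Longrightarrow> smooth_on U f \<Longrightarrow> smooth_on U g \<Longrightarrow> smooth_on U (\<lambda>x. f x + g x)"
  by (simp add: smooth_on_def differentiable_upto_add)

lemma smooth_on_diff:
  fixes f g :: "'u::real_normed_vector \<Rightarrow> 'v::real_normed_vector"
  assumes "open U" "smooth_on U f" "smooth_on U g"
  shows "smooth_on U (\<lambda>x. f x - g x)"
  using smooth_on_add[OF assms(1,2) smooth_on_bounded_linear[OF assms(1) _ assms(3), of uminus]]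
  by (simp add: bounded_linear_minus bounded_linear_ident)

lemma smooth_on_mult:
  fixes f g :: "'u::real_normed_vector \<Rightarrow> real"
  shows "open U \<Longrightarrow> smooth_on U f \<Longrightarrow> smooth_on U g \<Longrightarrow> smooth_on U (\<lambda>x. f x * g x)"
  by (simp add: smooth_on_def differentiable_upto_bilinear[OF _ bounded_bilinear_mult])

lemma smooth_on_sum:
  assumes "open U" "\<And>i. i \<in> I \<Longrightarrow> smooth_on U (f i)"
  shows "smooth_on U (\<lambda>x. \<Sum>i\<in>I. f i x)"
  using assms(2)
  by (induction I rule: infinite_finite_induct) (auto intro: smooth_on_const smooth_on_add assms(1))

lemma smooth_on_frechet_derivative:
  "smooth_on U f \<Longrightarrow> smooth_on U (\<lambda>x. frechet_derivative f (at x) v)"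
  unfolding smooth_on_def by (metis differentiable_upto.simps(2))

lemma smooth_on_imp_differentiable:
  "smooth_on U f \<Longrightarrow> x \<in> U \<Longrightarrow> f differentiable (at x)"
  unfolding smooth_on_def by (metis differentiable_upto.simps(2))

lemma smooth_on_subset: "smooth_on V f \<Longrightarrow> U \<subseteq> V \<Longrightarrow> smooth_on U f"
proof -
  have "U \<subseteq> V \<Longrightarrow> differentiable_upto k V f \<Longrightarrow> differentiable_upto k U f" for k
    by (induction k arbitrary: f) auto
  then show "smooth_on V f \<Longrightarrow> U \<subseteq> V \<Longrightarrow> smooth_on U f"
    by (simp add: smooth_on_def)
qed

lemma smooth_on_partial: "smooth_on U f \<Longrightarrow> smooth_on U (partial a f)"
  using smooth_on_frechet_derivative[of U f "axis a 1"] by (simp add: partial_def[abs_def])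

lemma smooth_on_vec_nth: "open U \<Longrightarrow> smooth_on U f \<Longrightarrow> smooth_on U (\<lambda>x. f x $ i)"
  by (rule smooth_on_bounded_linear[OF _ bounded_linear_vec_nth])

text \<open>Serves \<open>smooth_on_vec_lambda\<close>: a vector-valued function is the sum of its
  components, each put in its slot by the linear map \<open>axis i\<close>.\<close>

lemma bounded_linear_axis: "bounded_linear (axis i :: 'v::real_normed_vector \<Rightarrow> 'v^'n::finite)"
proof (rule bounded_linear_intro)
  show "norm (axis i x :: 'v^'n) \<le> norm x * 1" for x :: 'v
  proof -
    have "norm (axis i x :: 'v^'n) \<le> (\<Sum>j\<in>UNIV. norm ((axis i x :: 'v^'n) $ j))"
      by (simp add: norm_vec_def L2_set_le_sum)
    also have "\<dots> = norm x"
      by (simp add: axis_def if_distrib cong: if_cong)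
    finally show ?thesis by simp
  qed
qed (simp_all add: axis_def vec_eq_iff)

lemma smooth_on_vec_lambda:
  fixes f :: "'n::finite \<Rightarrow> 'u::real_normed_vector \<Rightarrow> 'v::real_normed_vector"
  assumes "open U" "\<And>i. smooth_on U (f i)"
  shows "smooth_on U (\<lambda>x. \<chi> i. f i x)"
proof -
  have "(\<chi> i. f i x) = (\<Sum>i\<in>UNIV. axis i (f i x))" for x
    by (simp add: vec_eq_iff axis_def if_distrib cong: if_cong)
  then show ?thesis
    by (simp add: smooth_on_sum smooth_on_bounded_linear bounded_linear_axis assms)
qed

section \<open>Rules for partial derivatives and Jacobian matrices\<close>

lemma partialI: "(f has_derivative f') (at x) \<Longrightarrow> f' (axis a 1) = d \<Longrightarrow> partial a f x = d"
  unfolding partial_def using frechet_derivative_at by metis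

lemma jacobian_nth:
  "f differentiable (at x) \<Longrightarrow> jacobian f x $ i $ j = partial j (\<lambda>y. f y $ i) x"
proof -
  assume "f differentiable (at x)"
  then have "((\<lambda>y. f y $ i) has_derivative (\<lambda>v. frechet_derivative f (at x) v $ i)) (at x)"
    by (intro bounded_linear.has_derivative[OF bounded_linear_vec_nth])
      (simp flip: frechet_derivative_works)
  from partialI[OF this refl] show ?thesis
    by (simp add: jacobian_def matrix_def)
qed

lemma smooth_on_jacobian:
  assumes "open U" "smooth_on U f"
  shows "smooth_on U (jacobian f)"
  unfolding jacobian_def[abs_def] matrix_def
  by (intro smooth_on_vec_lambda smooth_on_vec_nth smooth_on_frechet_derivative assms)

text \<open>Expansion of the direction in the standard basis. In this form the derivative collapses
  to one partial derivative at \<open>axis a 1\<close>, so that \<open>partialI\<close> turns each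
  \<open>has_derivative\<close> rule into a rule for \<open>partial\<close>.\<close>

lemma has_derivative_partial:
  fixes f :: "real^'n::finite \<Rightarrow> real"
  assumes "f differentiable (at x)"
  shows "(f has_derivative (\<lambda>v. \<Sum>a\<in>UNIV. v $ a * partial a f x)) (at x)"
proof -
  have f: "(f has_derivative frechet_derivative f (at x)) (at x)"
    using assms frechet_derivative_works by blast
  interpret L: bounded_linear "frechet_derivative f (at x)"
    using f by (rule has_derivative_bounded_linear)
  have "frechet_derivative f (at x) v = (\<Sum>a\<in>UNIV. v $ a * partial a f x)" for v
  proof -
    have "v = (\<Sum>a\<in>UNIV. v $ a *\<^sub>R axis a 1)"
      by (simp add: vec_eq_iff axis_def if_distrib cong: if_cong)
    then have "frechet_derivative f (at x) v = (\<Sum>a\<in>UNIV. frechet_derivative f (at x) (v $ a *\<^sub>R axis a 1))"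
      by (metis L.sum)
    then show ?thesis by (simp add: L.scaleR partial_def)
  qed
  then show ?thesis using f by (metis (no_types, lifting) ext)
qed

lemma partial_cong:
  assumes "f differentiable (at x)" "open U" "x \<in> U" "\<And>y. y \<in> U \<Longrightarrow> f y = g y"
  shows "partial a f x = partial a g x"
  unfolding partial_def using frechet_derivative_transform_within_open[OF assms] by simp

lemma partial_const: "partial a (\<lambda>y. c) x = 0"
  by (simp add: partial_def)

lemma partial_add:
  "f differentiable (at x) \<Longrightarrow> g differentiable (at x) \<Longrightarrow>
    partial a (\<lambda>y. f y + g y) x = partial a f x + partial a g x"
  by (rule partialI[OF has_derivative_add[OF has_derivative_partial has_derivative_partial]])
    (auto simp: axis_def if_distrib if_distribR cong: if_cong)

lemma partial_sum:
  assumes "\<And>i. i \<in> I \<Longrightarrow> f i differentiable (at x)"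
  shows "partial a (\<lambda>y. \<Sum>i\<in>I. f i y) x = (\<Sum>i\<in>I. partial a (f i) x)"
  by (rule partialI[OF has_derivative_sum[OF has_derivative_partial]])
    (use assms in \<open>auto simp: axis_def if_distrib if_distribR cong: if_cong\<close>)

lemma partial_mult:
  "f differentiable (at x) \<Longrightarrow> g differentiable (at x) \<Longrightarrow>
    partial a (\<lambda>y. f y * g y) x = f x * partial a g x + partial a f x * g x"
  by (rule partialI[OF has_derivative_mult[OF has_derivative_partial has_derivative_partial]])
    (auto simp: axis_def if_distrib if_distribR cong: if_cong)

lemma partial_cmult:
  "f differentiable (at x) \<Longrightarrow> partial a (\<lambda>y. k * f y) x = k * partial a f x"
  by (rule partialI[OF has_derivative_mult_right[OF has_derivative_partial]])
    (auto simp: axis_def if_distrib if_distribR cong: if_cong)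

lemma partial_ln:
  "f differentiable (at x) \<Longrightarrow> 0 < f x \<Longrightarrow> partial a (\<lambda>y. ln (f y)) x = partial a f x / f x"
  by (rule partialI[OF has_derivative_ln[OF _ has_derivative_partial]])
    (auto simp: axis_def divide_inverse if_distrib if_distribR cong: if_cong)

lemma powr_differentiable:
  fixes f :: "'u::real_normed_vector \<Rightarrow> real"
  shows "f differentiable (at x) \<Longrightarrow> 0 < f x \<Longrightarrow> (\<lambda>y. f y powr r) differentiable (at x)"
  unfolding differentiable_def by (blast intro: has_derivative_powr[OF _ has_derivative_const])

text \<open>The logarithmic derivative is kept as a factor, because for a Jacobian determinant it
  becomes the correction term \<open>dlog\<close>.\<close>

lemma partial_powr:
  "f differentiable (at x) \<Longrightarrow> 0 < f x \<Longrightarrow>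
    partial a (\<lambda>y. f y powr r) x = f x powr r * r * (partial a f x / f x)"
  by (rule partialI[OF has_derivative_powr[OF has_derivative_partial has_derivative_const]])
    (auto simp: axis_def if_distrib if_distribR cong: if_cong)

lemma differentiable_nth:
  "f differentiable (at x) \<Longrightarrow> (\<lambda>y. f y $ i) differentiable (at x)"
  unfolding differentiable_def
  by (blast intro: bounded_linear.has_derivative[OF bounded_linear_vec_nth])

lemma partial_compose:
  fixes f :: "real^'n::finite \<Rightarrow> real" and \<psi> :: "real^'n \<Rightarrow> real^'n"
  assumes "\<psi> differentiable (at y)" "f differentiable (at (\<psi> y))"
  shows "partial a (\<lambda>z. f (\<psi> z)) y = (\<Sum>b\<in>UNIV. jacobian \<psi> y $ b $ a * partial b f (\<psi> y))"
proof -
  have \<psi>: "(\<psi> has_derivative frechet_derivative \<psi> (at y)) (at y)"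
    using assms(1) frechet_derivative_works by blast
  show ?thesis
    by (rule partialI[OF has_derivative_compose[OF \<psi> has_derivative_partial[OF assms(2)]]])
      (simp add: jacobian_def matrix_def)
qed

section \<open>Symmetry of second derivatives\<close>

text \<open>The mean value theorem in the direction \<open>v\<close> turns the second difference
  into \<open>h\<close> times an increment of the derivative along \<open>v\<close>, taken in the
  direction \<open>w\<close>. First-order expansion of that derivative at \<open>x\<close> gives the
  limit; continuity of second derivatives does not enter.\<close>

lemma second_difference_tendsto:
  fixes f :: "'u::real_normed_vector \<Rightarrow> real"
  assumes "open U" "x \<in> U" and df: "\<And>y. y \<in> U \<Longrightarrow> f differentiable (at y)"
    and G: "((\<lambda>y. frechet_derivative f (at y) v) has_derivative G) (at x)"
  shows "((\<lambda>h. (f (x + h *\<^sub>R v + h *\<^sub>R w) - f (x + h *\<^sub>R v) - f (x + h *\<^sub>R w) + f x) / h\<^sup>2)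
           \<longlongrightarrow> G w) (at_right 0)"
proof (rule tendstoI)
  fix \<epsilon> :: real assume "\<epsilon> > 0"
  define N where "N = norm v + norm w + 1"
  have N: "norm v < N" "norm w < N" "N > 0" "norm v + norm w < N"
    using norm_ge_zero[of v] norm_ge_zero[of w] unfolding N_def by linarith+
  \<comment> \<open>Two expansion errors of size \<open>e * (h * N)\<close> will occur; after
    division by \<open>h\<close> they add up to two thirds of \<epsilon>.\<close>
  define e where "e = \<epsilon> / (3 * N)"
  have "e > 0" using \<open>\<epsilon> > 0\<close> N by (simp add: e_def)
  interpret G: bounded_linear G using G by (rule has_derivative_bounded_linear)
  define g where "g y = frechet_derivative f (at y) v" for y
  obtain d where "d > 0" and d: "\<And>y. norm (y - x) < d \<Longrightarrow> norm (g y - g x - G (y - x)) \<le> e * norm (y - x)"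
    using G \<open>e > 0\<close> unfolding has_derivative_at_alt g_def by blast
  obtain r where "r > 0" and r: "\<And>y. norm (y - x) < r \<Longrightarrow> y \<in> U"
    using assms(1,2) unfolding open_dist by (metis dist_norm)
  have "\<bar>(f (x + h *\<^sub>R v + h *\<^sub>R w) - f (x + h *\<^sub>R v) - f (x + h *\<^sub>R w) + f x) / h\<^sup>2 - G w\<bar> < \<epsilon>"
    if h: "0 < h" "h < min r d / N" for h
  proof -
    have hN: "h * N < r" "h * N < d" using h N by (simp_all add: pos_less_divide_eq)
    have near: "norm (s *\<^sub>R v + t *\<^sub>R w) \<le> h * N" if "0 \<le> s" "s \<le> h" "0 \<le> t" "t \<le> h" for s t
    proof -
      have "norm (s *\<^sub>R v + t *\<^sub>R w) \<le> s * norm v + t * norm w"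
        using norm_triangle_ineq[of "s *\<^sub>R v" "t *\<^sub>R w"] that by simp
      also have "\<dots> \<le> h * norm v + h * norm w"
        using that by (intro add_mono mult_right_mono) auto
      also have "\<dots> \<le> h * N" using N(4) h(1) by (simp flip: distrib_left)
      finally show ?thesis .
    qed
    have U: "x + (s *\<^sub>R v + t *\<^sub>R w) \<in> U" if "0 \<le> s" "s \<le> h" "0 \<le> t" "t \<le> h" for s t
      using near[OF that] hN by (intro r) simp
    have est: "\<bar>g (x + (s *\<^sub>R v + t *\<^sub>R w)) - g x - G (s *\<^sub>R v + t *\<^sub>R w)\<bar> \<le> e * (h * N)"
      if "0 \<le> s" "s \<le> h" "0 \<le> t" "t \<le> h" for s t
      using d[of "x + (s *\<^sub>R v + t *\<^sub>R w)"] near[OF that] hN(2) \<open>e > 0\<close>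
      by (smt (verit) add_diff_cancel_left' mult_left_mono real_norm_def)
    have der: "((\<lambda>s. f (x + (s *\<^sub>R v + t *\<^sub>R w))) has_real_derivative g (x + (s *\<^sub>R v + t *\<^sub>R w))) (at s)"
      if "0 \<le> s" "s \<le> h" "0 \<le> t" "t \<le> h" for s t
    proof -
      have "(f has_derivative frechet_derivative f (at (x + (s *\<^sub>R v + t *\<^sub>R w)))) (at (x + (s *\<^sub>R v + t *\<^sub>R w)))"
        using df[OF U[OF that]] frechet_derivative_works by blast
      moreover have "((\<lambda>s. x + (s *\<^sub>R v + t *\<^sub>R w)) has_derivative (\<lambda>k. k *\<^sub>R v)) (at s)"
        by (auto intro!: derivative_eq_intros)
      ultimately have *: "((\<lambda>s. f (x + (s *\<^sub>R v + t *\<^sub>R w))) has_derivative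
          (\<lambda>k. frechet_derivative f (at (x + (s *\<^sub>R v + t *\<^sub>R w))) (k *\<^sub>R v))) (at s)"
        by (rule has_derivative_compose[rotated])
      have "linear (frechet_derivative f (at (x + (s *\<^sub>R v + t *\<^sub>R w))))"
        using df[OF U[OF that]] by (rule linear_frechet_derivative)
      then have "frechet_derivative f (at (x + (s *\<^sub>R v + t *\<^sub>R w))) (k *\<^sub>R v)
          = g (x + (s *\<^sub>R v + t *\<^sub>R w)) * k" for k
        by (simp add: linear_cmul g_def)
      with * show ?thesis unfolding has_field_derivative_def by simp
    qed
    \<comment> \<open>The function of \<open>s\<close> to which the mean value theorem applies is
      already a difference in the direction \<open>w\<close>; its endpoints \<open>0\<close> and
      \<open>h\<close> yield the four corner values.\<close>
    have "\<exists>z>0. z < h \<and> (f (x + (h *\<^sub>R v + h *\<^sub>R w)) - f (x + (h *\<^sub>R v + 0 *\<^sub>R w)))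
        - (f (x + (0 *\<^sub>R v + h *\<^sub>R w)) - f (x + (0 *\<^sub>R v + 0 *\<^sub>R w)))
      = (h - 0) * (g (x + (z *\<^sub>R v + h *\<^sub>R w)) - g (x + (z *\<^sub>R v + 0 *\<^sub>R w)))"
      using h by (intro MVT2[of 0 h "\<lambda>s. f (x + (s *\<^sub>R v + h *\<^sub>R w)) - f (x + (s *\<^sub>R v + 0 *\<^sub>R w))"]
          DERIV_diff der) auto
    then obtain z where z: "0 < z" "z < h"
      and eq: "f (x + h *\<^sub>R v + h *\<^sub>R w) - f (x + h *\<^sub>R v) - f (x + h *\<^sub>R w) + f x
        = h * (g (x + (z *\<^sub>R v + h *\<^sub>R w)) - g (x + (z *\<^sub>R v + 0 *\<^sub>R w)))"
      by (auto simp: algebra_simps)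
    \<comment> \<open>Both points are compared with \<open>x\<close>. By linearity of
      \<open>G\<close> the contributions of the unknown \<open>z\<close> cancel, which leaves
      \<open>h * G w\<close>.\<close>
    have "\<bar>g (x + (z *\<^sub>R v + h *\<^sub>R w)) - g (x + (z *\<^sub>R v + 0 *\<^sub>R w)) - h * G w\<bar> \<le> 2 * (e * (h * N))"
      using est[of z h] est[of z 0] z h by (simp add: G.add G.scaleR)
    also have "\<dots> = h * (2 * (e * N))" by simp
    finally have "\<bar>(g (x + (z *\<^sub>R v + h *\<^sub>R w)) - g (x + (z *\<^sub>R v + 0 *\<^sub>R w)) - h * G w) / h\<bar> \<le> 2 * (e * N)"
      using h(1) by (simp add: abs_divide pos_divide_le_eq mult.commute)
    also have "\<dots> < \<epsilon>" using \<open>\<epsilon> > 0\<close> N by (simp add: e_def)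
    finally show ?thesis unfolding eq using h(1)
      by (simp add: power2_eq_square diff_divide_distrib)
  qed
  moreover have "min r d / N > 0" using \<open>r > 0\<close> \<open>d > 0\<close> N by simp
  ultimately show "\<forall>\<^sub>F h in at_right 0. dist ((f (x + h *\<^sub>R v + h *\<^sub>R w) - f (x + h *\<^sub>R v)
      - f (x + h *\<^sub>R w) + f x) / h\<^sup>2) (G w) < \<epsilon>"
    unfolding eventually_at_right_field dist_real_def by blast
qed

text \<open>The second difference is symmetric in \<open>v\<close> and \<open>w\<close>, so its
  limit, computed in the two orders, gives both mixed derivatives.\<close>

lemma frechet_derivative_commute:
  fixes f :: "'u::real_normed_vector \<Rightarrow> real"
  assumes "open U" "x \<in> U" "smooth_on U f"
  shows "frechet_derivative (\<lambda>y. frechet_derivative f (at y) v) (at x) w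
       = frechet_derivative (\<lambda>y. frechet_derivative f (at y) w) (at x) v"
proof -
  have df: "f differentiable (at y)" if "y \<in> U" for y
    using smooth_on_imp_differentiable[OF assms(3) that] .
  have G: "((\<lambda>y. frechet_derivative f (at y) v) has_derivative
      frechet_derivative (\<lambda>y. frechet_derivative f (at y) v) (at x)) (at x)" for v
    using smooth_on_imp_differentiable[OF smooth_on_frechet_derivative[OF assms(3)] assms(2)]
      frechet_derivative_works by blast
  note lim = second_difference_tendsto[OF assms(1,2) df G]
  have "((\<lambda>h. (f (x + h *\<^sub>R v + h *\<^sub>R w) - f (x + h *\<^sub>R v) - f (x + h *\<^sub>R w) + f x) / h\<^sup>2)
      \<longlongrightarrow> frechet_derivative (\<lambda>y. frechet_derivative f (at y) w) (at x) v) (at_right 0)"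
    using lim[of w v] by (simp add: algebra_simps)
  then show ?thesis
    using tendsto_unique[OF trivial_limit_at_right_real lim[of v w]] by blast
qed

lemma partial_commute:
  "open U \<Longrightarrow> x \<in> U \<Longrightarrow> smooth_on U f \<Longrightarrow> partial a (partial b f) x = partial b (partial a f) x"
  using frechet_derivative_commute[of U x f] by (simp add: partial_def[abs_def])

section \<open>Derivative of the determinant\<close>

text \<open>Differentiate the Leibniz formula term by term. At the identity matrix only the identity
  permutation contributes, and its term is the trace.\<close>

lemma has_derivative_det_mat_1:
  "((det :: real^'n::finite^'n \<Rightarrow> real) has_derivative trace) (at (mat 1))"
proof -
  have nth: "bounded_linear (\<lambda>H :: real^'n^'n. H $ i $ j)" for i j
    using bounded_linear_compose[OF bounded_linear_vec_nth bounded_linear_vec_nth] by blast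
  have "((\<lambda>X :: real^'n^'n. \<Sum>p | p permutes UNIV. of_int (sign p) * (\<Prod>i\<in>UNIV. X $ i $ p i)) has_derivative
     (\<lambda>H. \<Sum>p | p permutes UNIV. of_int (sign p) *
        (\<Sum>i\<in>UNIV. H $ i $ p i * (\<Prod>j\<in>UNIV - {i}. mat 1 $ j $ p j)))) (at (mat 1))"
    by (intro has_derivative_sum has_derivative_mult_right has_derivative_prod
        bounded_linear_imp_has_derivative nth)
  moreover have "(\<Sum>p | p permutes UNIV. of_int (sign p) *
        (\<Sum>i\<in>UNIV. H $ i $ p i * (\<Prod>j\<in>UNIV - {i}. mat 1 $ j $ p j))) = trace H" for H :: "real^'n^'n"
  proof -
    let ?t = "\<lambda>p. of_int (sign p) * (\<Sum>i\<in>UNIV. H $ i $ p i * (\<Prod>j\<in>UNIV - {i}. mat 1 $ j $ p j))"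
    have "?t p = 0" if p: "p permutes UNIV" "p \<noteq> id" for p
    proof -
      obtain k where k: "p k \<noteq> k" using p(2) by fastforce
      then have pk: "p (p k) \<noteq> p k" using permutes_inj[OF p(1)] by (simp add: inj_eq)
      \<comment> \<open>The permutation moves both \<open>k\<close> and \<open>p k\<close>.
        Whichever index \<open>i\<close> is omitted, a moved index remains, and it selects an
        off-diagonal zero of the identity matrix.\<close>
      have "(\<Prod>j\<in>UNIV - {i}. (mat 1 :: real^'n^'n) $ j $ p j) = 0" for i
        using k pk by (intro prod_zero bexI[of _ "if i = k then p k else k"]) (auto simp: mat_def)
      then show ?thesis by (simp only: mult_zero_right sum.neutral_const)
    qed
    then have "(\<Sum>p | p permutes UNIV. ?t p) = (\<Sum>p\<in>{id}. ?t p)"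
      by (intro sum.mono_neutral_right) (auto simp: permutes_id)
    also have "\<dots> = trace H" by (simp add: trace_def mat_def sign_id)
    finally show ?thesis .
  qed
  ultimately show ?thesis by (simp add: det_def[abs_def])
qed

text \<open>Jacobi's formula. Left multiplication by the inverse \<open>B\<close> moves the base
  point to the identity matrix, and multiplicativity of the determinant restores the factor
  \<open>det (F x)\<close>.\<close>

lemma has_derivative_det:
  fixes F :: "'u::real_normed_vector \<Rightarrow> real^'n::finite^'n"
  assumes F: "(F has_derivative F') (at x)" and inv: "F x ** B = mat 1"
  shows "((\<lambda>y. det (F y)) has_derivative (\<lambda>h. det (F x) * trace (B ** F' h))) (at x)"
proof -
  have inv': "B ** F x = mat 1" using inv matrix_left_right_inverse by blast
  have lin: "bounded_linear (\<lambda>X :: real^'n^'n. B ** X)"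
    by (intro linear_conv_bounded_linear[THEN iffD1] linearI)
      (simp_all add: matrix_matrix_mult_def vec_eq_iff sum.distrib sum_distrib_left algebra_simps)
  have "((\<lambda>y. B ** F y) has_derivative (\<lambda>h. B ** F' h)) (at x)"
    by (rule bounded_linear.has_derivative[OF lin F])
  then have "((\<lambda>y. det (F x) * det (B ** F y)) has_derivative (\<lambda>h. det (F x) * trace (B ** F' h))) (at x)"
    using has_derivative_compose[of "\<lambda>y. B ** F y" _ x UNIV det trace] has_derivative_det_mat_1
    by (intro has_derivative_mult_right) (simp add: inv')
  moreover have "det (F x) * det (B ** F y) = det (F y)" for y
    using arg_cong[OF inv, of det] by (simp add: det_mul)
  ultimately show ?thesis by simp
qed

section \<open>Covariance of the operator\<close>

text \<open>The coordinate expression of \<open>Delta_sing\<close> for bare coefficient functions.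
  Covariance can thus be proved between two open subsets of Euclidean space, without mention of
  charts.\<close>

definition sing_op ::
  "real \<Rightarrow> (real^'n::finite \<Rightarrow> real^'n^'n) \<Rightarrow> (real^'n \<Rightarrow> real^'n) \<Rightarrow> (real^'n \<Rightarrow> real) \<Rightarrow> real^'n \<Rightarrow> real"
  where
  "sing_op \<delta> S \<gamma> s x = 1/2 *
     ((\<Sum>a\<in>UNIV. \<Sum>b\<in>UNIV. S x $ a $ b * partial a (partial b s) x)
      + (\<Sum>a\<in>UNIV. (\<Sum>b\<in>UNIV. partial b (\<lambda>y. S y $ b $ a) x) * partial a s x)
      + (1 - \<delta>) / 2 *
          ((\<Sum>a\<in>UNIV. partial a (\<lambda>y. \<Sum>b\<in>UNIV. S y $ a $ b * \<gamma> y $ b) x)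
           + (\<delta> - 1) / 2 * (\<Sum>a\<in>UNIV. \<gamma> x $ a * (\<Sum>b\<in>UNIV. S x $ a $ b * \<gamma> x $ b))) * s x)"

text \<open>The connection extended from volume forms, the case \<open>w = 1\<close>, to densities
  of weight \<open>w\<close>.\<close>

definition covariant_partial ::
  "real \<Rightarrow> (real^'n::finite \<Rightarrow> real^'n) \<Rightarrow> 'n \<Rightarrow> (real^'n \<Rightarrow> real) \<Rightarrow> real^'n \<Rightarrow> real" where
  "covariant_partial w \<gamma> a s x = partial a s x + w * \<gamma> x $ a * s x"

definition flux ::
  "real \<Rightarrow> (real^'n::finite \<Rightarrow> real^'n^'n) \<Rightarrow> (real^'n \<Rightarrow> real^'n) \<Rightarrow> (real^'n \<Rightarrow> real) \<Rightarrow> 'n \<Rightarrow> real^'n \<Rightarrow> real"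
  where
  "flux w S \<gamma> s a x = (\<Sum>b\<in>UNIV. S x $ a $ b * covariant_partial w \<gamma> b s x)"

lemma smooth_on_flux:
  assumes "open U" "smooth_on U S" "smooth_on U \<gamma>" "smooth_on U s"
  shows "smooth_on U (flux w S \<gamma> s a)"
  unfolding flux_def[abs_def] covariant_partial_def
  by (intro smooth_on_sum smooth_on_mult smooth_on_add smooth_on_vec_nth smooth_on_partial
      smooth_on_const assms)

text \<open>A vector density of weight \<open>\<mu>\<close> has the covariant divergence \<open>\<partial>\<^sub>a V\<^sup>a + (\<mu> - 1) \<gamma>\<^sub>a V\<^sup>a\<close>; the
  flux has weight \<open>\<mu> = 1 - w\<close>.\<close>

lemma sing_op_divergence_form:
  assumes U: "open U" "x \<in> U" and smooth: "smooth_on U S" "smooth_on U \<gamma>" "smooth_on U s"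
    and symmetric: "\<And>a b. S x $ a $ b = S x $ b $ a"
    and w: "w = (1 - \<delta>) / 2"
  shows "sing_op \<delta> S \<gamma> s x =
    1/2 * ((\<Sum>a\<in>UNIV. partial a (flux w S \<gamma> s a) x) - w * (\<Sum>a\<in>UNIV. \<gamma> x $ a * flux w S \<gamma> s a x))"
proof -
  define g where "g a y = (\<Sum>b\<in>UNIV. S y $ a $ b * \<gamma> y $ b)" for a y
  have dS: "(\<lambda>y. S y $ a $ b) differentiable (at x)" for a b
    by (intro smooth_on_imp_differentiable[of U] smooth_on_vec_nth U smooth)
  have ds: "s differentiable (at x)" and dps: "partial b s differentiable (at x)" for b
    by (intro smooth_on_imp_differentiable[of U] smooth_on_partial U smooth)+
  have dg: "g a differentiable (at x)" for a
    unfolding g_def by (intro smooth_on_imp_differentiable[of U] smooth_on_sum smooth_on_mult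
        smooth_on_vec_nth U smooth)
  have flux: "flux w S \<gamma> s a = (\<lambda>y. (\<Sum>b\<in>UNIV. S y $ a $ b * partial b s y) + w * (g a y * s y))" for a
    by (simp add: fun_eq_iff flux_def covariant_partial_def g_def sum_distrib_left sum_distrib_right
        sum.distrib algebra_simps)
  have "partial a (flux w S \<gamma> s a) x = (\<Sum>b\<in>UNIV. S x $ a $ b * partial a (partial b s) x)
      + (\<Sum>b\<in>UNIV. partial a (\<lambda>y. S y $ a $ b) x * partial b s x)
      + w * (partial a (g a) x * s x) + w * (g a x * partial a s x)" for a
    unfolding flux
    by (simp add: partial_add partial_sum partial_mult partial_const dS ds dps dg sum.distrib
        distrib_left)
  then have "(\<Sum>a\<in>UNIV. partial a (flux w S \<gamma> s a) x) =
      (\<Sum>a\<in>UNIV. \<Sum>b\<in>UNIV. S x $ a $ b * partial a (partial b s) x)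
      + (\<Sum>a\<in>UNIV. \<Sum>b\<in>UNIV. partial a (\<lambda>y. S y $ a $ b) x * partial b s x)
      + w * (\<Sum>a\<in>UNIV. partial a (g a) x) * s x + w * (\<Sum>a\<in>UNIV. g a x * partial a s x)"
    by (simp add: sum.distrib sum_distrib_left sum_distrib_right mult.assoc)
  moreover have "(\<Sum>a\<in>UNIV. \<Sum>b\<in>UNIV. partial a (\<lambda>y. S y $ a $ b) x * partial b s x)
      = (\<Sum>a\<in>UNIV. (\<Sum>b\<in>UNIV. partial b (\<lambda>y. S y $ b $ a) x) * partial a s x)"
    by (subst sum.swap) (simp add: sum_distrib_right)
  \<comment> \<open>Symmetry of \<open>S\<close> at \<open>x\<close> identifies the contraction of
    \<gamma> on the first index with \<open>g\<close>. The first-order terms containing \<gamma>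
    then cancel between the divergence and its correction.\<close>
  moreover have "(\<Sum>a\<in>UNIV. \<gamma> x $ a * flux w S \<gamma> s a x)
      = (\<Sum>a\<in>UNIV. g a x * partial a s x) + w * (\<Sum>a\<in>UNIV. \<gamma> x $ a * g a x) * s x"
  proof -
    have "(\<Sum>a\<in>UNIV. \<gamma> x $ a * (\<Sum>b\<in>UNIV. S x $ a $ b * partial b s x))
        = (\<Sum>b\<in>UNIV. \<Sum>a\<in>UNIV. \<gamma> x $ a * (S x $ a $ b * partial b s x))"
      by (simp add: sum_distrib_left) (rule sum.swap)
    also have "\<dots> = (\<Sum>b\<in>UNIV. g b x * partial b s x)"
      unfolding g_def sum_distrib_right by (intro sum.cong refl) (subst symmetric, simp)
    finally show ?thesis
      by (simp add: flux distrib_left sum.distrib sum_distrib_left sum_distrib_right mult_ac)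
  qed
  \<comment> \<open>The remaining terms have coefficients \<open>w\<close> and
    \<open>- w * w\<close>, which are those of the potential in \<open>sing_op\<close>.\<close>
  moreover have coeff: "(1 - \<delta>) / 2 = w" "(\<delta> - 1) / 2 = - w"
    using w by (simp_all add: field_simps)
  ultimately show ?thesis
    unfolding sing_op_def g_def[THEN sym] coeff by (simp add: algebra_simps)
qed

text \<open>Used in both directions: to insert a Jacobian matrix together with its inverse, and to
  remove such a pair.\<close>

lemma sum_contract:
  fixes P Q :: "'n::finite \<Rightarrow> 'n \<Rightarrow> real"
  assumes "\<And>i k. (\<Sum>j\<in>UNIV. P i j * Q j k) = (if i = k then 1 else 0)"
  shows "(\<Sum>i\<in>UNIV. \<Sum>j\<in>UNIV. P i j * (\<Sum>k\<in>UNIV. Q j k * X i k)) = (\<Sum>i\<in>UNIV. X i i)"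
proof (rule sum.cong[OF refl])
  fix i
  have "(\<Sum>j\<in>UNIV. P i j * (\<Sum>k\<in>UNIV. Q j k * X i k)) = (\<Sum>k\<in>UNIV. (\<Sum>j\<in>UNIV. P i j * Q j k) * X i k)"
    by (simp add: sum_distrib_left sum_distrib_right mult.assoc) (rule sum.swap)
  also have "\<dots> = X i i"
    by (simp add: assms mult_if_delta)
  finally show "(\<Sum>j\<in>UNIV. P i j * (\<Sum>k\<in>UNIV. Q j k * X i k)) = X i i" .
qed

text \<open>The map \<open>\<psi>\<close> expresses the coordinates on \<open>V\<close> through those on \<open>U\<close>.\<close>

locale coordinate_change =
  fixes U V :: "(real^'n::finite) set" and \<psi> \<phi> :: "real^'n \<Rightarrow> real^'n"
  assumes open_U: "open U" and open_V: "open V"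
    and \<psi>_in: "y \<in> U \<Longrightarrow> \<psi> y \<in> V" and \<phi>_in: "x \<in> V \<Longrightarrow> \<phi> x \<in> U"
    and \<phi>_\<psi>: "y \<in> U \<Longrightarrow> \<phi> (\<psi> y) = y" and \<psi>_\<phi>: "x \<in> V \<Longrightarrow> \<psi> (\<phi> x) = x"
    and smooth_\<psi>: "smooth_on U \<psi>" and smooth_\<phi>: "smooth_on V \<phi>"
    and det_pos: "y \<in> U \<Longrightarrow> 0 < det (jacobian \<psi> y)"
begin

section \<open>The Jacobian of a coordinate change and its determinant\<close>

abbreviation D :: "real^'n \<Rightarrow> real" where
  "D y \<equiv> det (jacobian \<psi> y)"

text \<open>The inhomogeneous term of the transformation laws below; covariance amounts to the
  cancellation of its occurrences.\<close>

definition dlog :: "'n \<Rightarrow> real^'n \<Rightarrow> real" where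
  "dlog a y = partial a (\<lambda>z. ln (D z)) y"

lemma \<psi>_differentiable: "y \<in> U \<Longrightarrow> \<psi> differentiable (at y)"
  using smooth_\<psi> by (rule smooth_on_imp_differentiable)

lemma jacobian_differentiable: "y \<in> U \<Longrightarrow> jacobian \<psi> differentiable (at y)"
  by (rule smooth_on_imp_differentiable[OF smooth_on_jacobian[OF open_U smooth_\<psi>]])

text \<open>The chain rule for \<psi> after \<phi>, which is the identity on the open set
  \<open>V\<close>.\<close>

lemma jacobian_inverse:
  assumes "y \<in> U"
  shows "jacobian \<psi> y ** jacobian \<phi> (\<psi> y) = mat 1"
proof -
  let ?x = "\<psi> y"
  have x: "?x \<in> V" "\<phi> ?x = y" using assms \<psi>_in \<phi>_\<psi> by auto
  have d: "\<psi> differentiable (at (\<phi> ?x))" "\<phi> differentiable (at ?x)"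
    using x assms \<psi>_differentiable smooth_on_imp_differentiable[OF smooth_\<phi>] by auto
  have "(jacobian \<psi> y ** jacobian \<phi> ?x) $ i $ a = mat 1 $ i $ a" for i a
  proof -
    have "((\<lambda>x :: real^'n. x $ i) has_derivative (\<lambda>v. v $ i)) (at ?x)"
      by (rule bounded_linear_imp_has_derivative[OF bounded_linear_vec_nth])
    from partialI[OF this refl] have "partial a (\<lambda>x. x $ i) ?x = mat 1 $ i $ a"
      by (simp add: axis_def mat_def)
    moreover have "partial a (\<lambda>x. x $ i) ?x = partial a (\<lambda>x. \<psi> (\<phi> x) $ i) ?x"
      by (rule partial_cong[OF _ open_V x(1)])
        (use \<psi>_\<phi> differentiable_nth[of "\<lambda>x. x"] in auto)
    moreover have "\<dots> = (\<Sum>b\<in>UNIV. jacobian \<phi> ?x $ b $ a * partial b (\<lambda>z. \<psi> z $ i) (\<phi> ?x))"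
      by (rule partial_compose[OF d(2) differentiable_nth[OF d(1)]])
    ultimately show ?thesis
      using x by (simp add: matrix_matrix_mult_def jacobian_nth[OF d(1), unfolded x] mult.commute)
  qed
  then show ?thesis by (simp add: vec_eq_iff)
qed

lemma jacobian_inverse_sum:
  assumes "y \<in> U"
  shows "(\<Sum>b\<in>UNIV. jacobian \<psi> y $ a $ b * jacobian \<phi> (\<psi> y) $ b $ c) = (if a = c then 1 else 0)"
    and "(\<Sum>b\<in>UNIV. jacobian \<phi> (\<psi> y) $ a $ b * jacobian \<psi> y $ b $ c) = (if a = c then 1 else 0)"
proof -
  have "(jacobian \<psi> y ** jacobian \<phi> (\<psi> y)) $ a $ c = mat 1 $ a $ c"
    "(jacobian \<phi> (\<psi> y) ** jacobian \<psi> y) $ a $ c = mat 1 $ a $ c"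
    using jacobian_inverse[OF assms] matrix_left_right_inverse by metis+
  then show "(\<Sum>b\<in>UNIV. jacobian \<psi> y $ a $ b * jacobian \<phi> (\<psi> y) $ b $ c) = (if a = c then 1 else 0)"
    "(\<Sum>b\<in>UNIV. jacobian \<phi> (\<psi> y) $ a $ b * jacobian \<psi> y $ b $ c) = (if a = c then 1 else 0)"
    by (simp_all add: matrix_matrix_mult_def mat_def)
qed

lemma det_jacobian_inverse: "y \<in> U \<Longrightarrow> det (jacobian \<phi> (\<psi> y)) = inverse (D y)"
  using arg_cong[OF jacobian_inverse, of y det] by (simp add: det_mul inverse_unique)

text \<open>Both sides are mixed second derivatives of the component \<open>a\<close> of
  \<psi>.\<close>

lemma jacobian_partial_commute:
  assumes "y \<in> U"
  shows "partial c (\<lambda>z. jacobian \<psi> z $ a $ e) y = partial e (\<lambda>z. jacobian \<psi> z $ a $ c) y"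
proof -
  have "partial c (\<lambda>z. jacobian \<psi> z $ a $ e) y = partial c (partial e (\<lambda>w. \<psi> w $ a)) y" for c e
    by (rule partial_cong[OF _ open_U assms])
      (simp_all add: assms jacobian_nth \<psi>_differentiable jacobian_differentiable differentiable_nth)
  then show ?thesis
    by (simp add: partial_commute[OF open_U assms smooth_on_vec_nth[OF open_U smooth_\<psi>]])
qed

lemma has_derivative_D:
  assumes "y \<in> U"
  shows "(D has_derivative (\<lambda>h. D y *
    trace (jacobian \<phi> (\<psi> y) ** frechet_derivative (jacobian \<psi>) (at y) h))) (at y)"
proof -
  have "(jacobian \<psi> has_derivative frechet_derivative (jacobian \<psi>) (at y)) (at y)"
    using jacobian_differentiable[OF assms] frechet_derivative_works by blast
  then show ?thesis
    by (rule has_derivative_det) (rule jacobian_inverse[OF assms])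
qed

lemma D_differentiable: "y \<in> U \<Longrightarrow> D differentiable (at y)"
  using has_derivative_D differentiableI by blast

lemma partial_D: "y \<in> U \<Longrightarrow> partial c D y / D y = dlog c y"
  by (simp add: dlog_def partial_ln D_differentiable det_pos)

text \<open>Jacobi's formula together with the symmetry of second derivatives.\<close>

lemma dlog_eq:
  assumes "y \<in> U"
  shows "dlog c y = (\<Sum>e\<in>UNIV. \<Sum>a\<in>UNIV.
    jacobian \<phi> (\<psi> y) $ e $ a * partial e (\<lambda>z. jacobian \<psi> z $ a $ c) y)"
proof -
  have J: "(jacobian \<psi> has_derivative frechet_derivative (jacobian \<psi>) (at y)) (at y)"
    using jacobian_differentiable[OF assms] frechet_derivative_works by blast
  have nth: "bounded_linear (\<lambda>H :: real^'n^'n. H $ a $ e)" for a e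
    using bounded_linear_compose[OF bounded_linear_vec_nth bounded_linear_vec_nth] by blast
  \<comment> \<open>The direction \<open>c\<close> and the column \<open>e\<close> are exchanged
    here; this gives the trace the shape in which second derivatives of \<psi> appear in
    \<open>divergence_transform\<close>.\<close>
  have "frechet_derivative (jacobian \<psi>) (at y) (axis c 1) $ a $ e
      = partial e (\<lambda>z. jacobian \<psi> z $ a $ c) y" for a e
    using partialI[OF bounded_linear.has_derivative[OF nth J] refl]
      jacobian_partial_commute[OF assms] by simp
  then have "partial c D y = D y * (\<Sum>e\<in>UNIV. \<Sum>a\<in>UNIV.
      jacobian \<phi> (\<psi> y) $ e $ a * partial e (\<lambda>z. jacobian \<psi> z $ a $ c) y)"
    using partialI[OF has_derivative_D[OF assms] refl]
    by (simp add: trace_def matrix_matrix_mult_def)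
  then show ?thesis using partial_D[OF assms] det_pos[OF assms] by (simp add: field_simps)
qed

text \<open>The correction has two sources: differentiating the power of \<open>D\<close> gives
  \<open>r\<close> times \<open>dlog\<close>, and differentiating the Jacobian gives one further
  \<open>dlog\<close> by Jacobi's formula. They cancel only for \<open>r = - 1\<close>, the
  classical divergence of a vector density of weight one.\<close>

lemma divergence_transform:
  assumes y: "y \<in> U"
    and dW: "\<And>a. W a differentiable (at (\<psi> y))" and dW': "\<And>c. W' c differentiable (at y)"
    and W: "\<And>z a. z \<in> U \<Longrightarrow> W a (\<psi> z) = D z powr r * (\<Sum>c\<in>UNIV. jacobian \<psi> z $ a $ c * W' c z)"
  shows "(\<Sum>a\<in>UNIV. partial a (W a) (\<psi> y)) =
    D y powr r * ((\<Sum>c\<in>UNIV. partial c (W' c) y) + (r + 1) * (\<Sum>c\<in>UNIV. dlog c y * W' c y))"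
proof -
  define K where "K a b = jacobian \<psi> y $ a $ b" for a b
  define G where "G a b = jacobian \<phi> (\<psi> y) $ a $ b" for a b
  define dK where "dK e a c = partial e (\<lambda>z. jacobian \<psi> z $ a $ c) y" for e a c
  have KG: "(\<Sum>b\<in>UNIV. K a b * G b c) = (if a = c then 1 else 0)"
    and GK: "(\<Sum>b\<in>UNIV. G a b * K b c) = (if a = c then 1 else 0)" for a c
    using jacobian_inverse_sum[OF y] by (simp_all add: K_def G_def)
  have KG': "(\<Sum>b\<in>UNIV. G b c * K a b) = (if c = a then 1 else 0)" for a c
    using KG[of a c] by (auto simp: mult.commute)
  have dJ: "(\<lambda>z. jacobian \<psi> z $ a $ c) differentiable (at y)" for a c
    by (intro differentiable_nth jacobian_differentiable y)
  have dP: "(\<lambda>z. D z powr r) differentiable (at y)"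
    by (rule powr_differentiable[OF D_differentiable[OF y] det_pos[OF y]])
  have dS: "(\<lambda>z. \<Sum>c\<in>UNIV. jacobian \<psi> z $ a $ c * W' c z) differentiable (at y)" for a
    by (intro differentiable_sum ballI differentiable_mult dJ dW') auto
  \<comment> \<open>The pullback of \<open>W a\<close> is differentiated twice over: by the chain
    rule, and through its expression in \<open>W'\<close>.\<close>
  have chain: "(\<Sum>b\<in>UNIV. K b e * partial b (W a) (\<psi> y)) =
      D y powr r * ((\<Sum>c\<in>UNIV. K a c * (partial e (W' c) y + r * dlog e y * W' c y))
        + (\<Sum>c\<in>UNIV. dK e a c * W' c y))" for a e
  proof -
    have "(\<Sum>b\<in>UNIV. K b e * partial b (W a) (\<psi> y)) = partial e (\<lambda>z. W a (\<psi> z)) y"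
      by (simp add: K_def partial_compose[OF \<psi>_differentiable[OF y] dW])
    also have "\<dots> = partial e (\<lambda>z. D z powr r * (\<Sum>c\<in>UNIV. jacobian \<psi> z $ a $ c * W' c z)) y"
      by (rule sym[OF partial_cong[OF _ open_U y]]) (auto simp: W intro!: differentiable_mult dP dS)
    also have "\<dots> = D y powr r * (\<Sum>c\<in>UNIV. K a c * partial e (W' c) y + dK e a c * W' c y)
        + D y powr r * r * dlog e y * (\<Sum>c\<in>UNIV. K a c * W' c y)"
      by (simp add: partial_mult dP dS partial_sum dJ dW' partial_powr D_differentiable[OF y] y
          det_pos partial_D K_def dK_def)
    finally show ?thesis
      by (simp add: sum.distrib sum_distrib_left algebra_simps)
  qed
  \<comment> \<open>Inserting the inverse Jacobian expresses the divergence through the left-hand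
    sides of \<open>chain\<close>.\<close>
  have "(\<Sum>a\<in>UNIV. partial a (W a) (\<psi> y)) =
      (\<Sum>a\<in>UNIV. \<Sum>e\<in>UNIV. G e a * (\<Sum>b\<in>UNIV. K b e * partial b (W a) (\<psi> y)))"
    by (rule sym[OF sum_contract[OF KG']])
  also have "\<dots> = (\<Sum>e\<in>UNIV. \<Sum>a\<in>UNIV. G e a * (\<Sum>b\<in>UNIV. K b e * partial b (W a) (\<psi> y)))"
    by (rule sum.swap)
  also have "\<dots> = D y powr r *
      ((\<Sum>e\<in>UNIV. \<Sum>a\<in>UNIV. G e a * (\<Sum>c\<in>UNIV. K a c * (partial e (W' c) y + r * dlog e y * W' c y)))
        + (\<Sum>e\<in>UNIV. \<Sum>a\<in>UNIV. \<Sum>c\<in>UNIV. G e a * dK e a c * W' c y))"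
    unfolding chain
    by (simp add: sum_distrib_left[of "D y powr r"] sum_distrib_left[of "G _ _"] sum.distrib
        distrib_left mult.left_commute mult.assoc)
  also have "(\<Sum>e\<in>UNIV. \<Sum>a\<in>UNIV. G e a * (\<Sum>c\<in>UNIV. K a c * (partial e (W' c) y + r * dlog e y * W' c y)))
      = (\<Sum>c\<in>UNIV. partial c (W' c) y + r * dlog c y * W' c y)"
    by (rule sum_contract[OF GK])
  \<comment> \<open>With \<open>c\<close> outermost, the two inner sums form the expression for
    \<open>dlog c y\<close> in \<open>dlog_eq\<close>.\<close>
  also have "(\<Sum>e\<in>UNIV. \<Sum>a\<in>UNIV. \<Sum>c\<in>UNIV. G e a * dK e a c * W' c y)
      = (\<Sum>c\<in>UNIV. \<Sum>e\<in>UNIV. \<Sum>a\<in>UNIV. G e a * dK e a c * W' c y)"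
    by (subst sum.swap[of _ UNIV UNIV], subst (2) sum.swap) (rule refl)
  also have "\<dots> = (\<Sum>c\<in>UNIV. dlog c y * W' c y)"
    by (simp add: dlog_eq[OF y] G_def dK_def sum_distrib_right)
  finally show ?thesis
    by (simp add: sum.distrib sum_distrib_left algebra_simps)
qed

section \<open>One set of geometric data in two coordinate systems: unprimed on \<open>V\<close>,
  primed on \<open>U\<close>\<close>

context
  fixes \<delta> w :: real
    and S S' :: "real^'n \<Rightarrow> real^'n^'n" and \<gamma> \<gamma>' :: "real^'n \<Rightarrow> real^'n" and s s' :: "real^'n \<Rightarrow> real"
  assumes w: "w = (1 - \<delta>) / 2"
    and smooth: "smooth_on V S" "smooth_on V \<gamma>" "smooth_on V s"
    and smooth': "smooth_on U S'" "smooth_on U \<gamma>'" "smooth_on U s'"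
    and symmetric: "\<And>x a b. x \<in> V \<Longrightarrow> S x $ a $ b = S x $ b $ a"
    and symmetric': "\<And>y a b. y \<in> U \<Longrightarrow> S' y $ a $ b = S' y $ b $ a"
    and s: "\<And>y. y \<in> U \<Longrightarrow> s' y = s (\<psi> y) * \<bar>D y\<bar> powr w"
    and S: "\<And>y a b. y \<in> U \<Longrightarrow> S (\<psi> y) $ a $ b = D y powr (- \<delta>) *
        (\<Sum>c\<in>UNIV. \<Sum>d\<in>UNIV. jacobian \<psi> y $ a $ c * jacobian \<psi> y $ b $ d * S' y $ c $ d)"
    and \<gamma>: "\<And>y a. y \<in> U \<Longrightarrow> \<gamma>' y $ a = (\<Sum>b\<in>UNIV. jacobian \<psi> y $ b $ a *
        (\<gamma> (\<psi> y) $ b + partial b (\<lambda>x. ln \<bar>det (jacobian \<phi> x)\<bar>) (\<psi> y)))"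
begin

text \<open>The assumed law contains the determinant of the inverse change \<phi>. By the chain rule
  its logarithmic term becomes the derivative of
  \<open>ln (det (jacobian \<phi> (\<psi> z)))\<close>, which is \<open>- ln (D z)\<close>.\<close>

lemma connection_transform:
  assumes y: "y \<in> U"
  shows "\<gamma>' y $ a = (\<Sum>b\<in>UNIV. jacobian \<psi> y $ b $ a * \<gamma> (\<psi> y) $ b) - dlog a y"
proof -
  let ?h = "\<lambda>x. ln (det (jacobian \<phi> x))"
  have pos: "0 < det (jacobian \<phi> x)" if "x \<in> V" for x
    using that det_jacobian_inverse[of "\<phi> x"] det_pos[of "\<phi> x"] \<psi>_\<phi> \<phi>_in by simp
  \<comment> \<open>The reversed change is again a coordinate change, which supplies
    differentiability of the determinant of \<phi>.\<close>
  interpret inv: coordinate_change V U \<phi> \<psi>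
    by unfold_locales (use open_U open_V \<psi>_in \<phi>_in \<phi>_\<psi> \<psi>_\<phi> smooth_\<psi> smooth_\<phi> pos in auto)
  have h: "?h differentiable (at x)" if "x \<in> V" for x
    using has_derivative_ln[OF pos inv.has_derivative_D] that differentiableI by blast
  have "partial b (\<lambda>x. ln \<bar>det (jacobian \<phi> x)\<bar>) (\<psi> y) = partial b ?h (\<psi> y)" for b
    by (rule sym[OF partial_cong[OF h open_V]]) (simp_all add: \<psi>_in[OF y] pos abs_of_pos)
  then have "\<gamma>' y $ a = (\<Sum>b\<in>UNIV. jacobian \<psi> y $ b $ a * \<gamma> (\<psi> y) $ b)
      + (\<Sum>b\<in>UNIV. jacobian \<psi> y $ b $ a * partial b ?h (\<psi> y))"
    by (simp add: \<gamma>[OF y] distrib_left sum.distrib)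
  also have "(\<Sum>b\<in>UNIV. jacobian \<psi> y $ b $ a * partial b ?h (\<psi> y)) = partial a (\<lambda>z. ?h (\<psi> z)) y"
    by (rule sym[OF partial_compose[OF \<psi>_differentiable[OF y] h[OF \<psi>_in[OF y]]]])
  also have "\<dots> = partial a (\<lambda>z. (- 1) * ln (D z)) y"
  proof (rule sym[OF partial_cong[OF _ open_U y]])
    show "(\<lambda>z. (- 1) * ln (D z)) differentiable (at y)"
      using has_derivative_mult_right[OF has_derivative_ln[OF det_pos has_derivative_D]] y
        differentiableI by blast
  qed (simp add: det_jacobian_inverse ln_inverse det_pos)
  also have "\<dots> = (- 1) * dlog a y"
    unfolding dlog_def using has_derivative_ln[OF det_pos has_derivative_D] y differentiableI
    by (intro partial_cmult) blast
  finally show ?thesis by simp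
qed

text \<open>Differentiating the factor \<open>D z powr w\<close> produces
  \<open>w * dlog a y\<close>, which cancels against the inhomogeneous term of the
  connection.\<close>

lemma covariant_partial_transform:
  assumes y: "y \<in> U"
  shows "covariant_partial w \<gamma>' a s' y =
    D y powr w * (\<Sum>b\<in>UNIV. jacobian \<psi> y $ b $ a * covariant_partial w \<gamma> b s (\<psi> y))"
proof -
  have ds: "s differentiable (at (\<psi> y))"
    by (rule smooth_on_imp_differentiable[OF smooth(3) \<psi>_in[OF y]])
  have dc: "(\<lambda>z. s (\<psi> z)) differentiable (at y)"
    using differentiable_chain_at[OF \<psi>_differentiable[OF y] ds] by (simp add: o_def)
  have dP: "(\<lambda>z. D z powr w) differentiable (at y)"
    by (rule powr_differentiable[OF D_differentiable[OF y] det_pos[OF y]])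
  have eq: "s' z = s (\<psi> z) * D z powr w" if "z \<in> U" for z
    using s[OF that] det_pos[OF that] by simp
  have "partial a s' y = partial a (\<lambda>z. s (\<psi> z) * D z powr w) y"
    by (rule partial_cong[OF smooth_on_imp_differentiable[OF smooth'(3) y] open_U y eq])
  also have "\<dots> = D y powr w *
      ((\<Sum>b\<in>UNIV. jacobian \<psi> y $ b $ a * partial b s (\<psi> y)) + w * dlog a y * s (\<psi> y))"
    by (simp add: partial_mult dc dP partial_compose[OF \<psi>_differentiable[OF y] ds] partial_powr
        D_differentiable[OF y] y det_pos partial_D algebra_simps)
  finally show ?thesis
    by (simp add: covariant_partial_def eq[OF y] connection_transform[OF y] sum.distrib
        sum_distrib_left algebra_simps)
qed

text \<open>The powers match because \<open>(w - 1) + w = - \<delta>\<close>: the covariant gradient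
  accounts for one factor \<open>D y powr w\<close>, and the tensor density for
  \<open>D y powr (- \<delta>)\<close>.\<close>

lemma flux_transform:
  assumes y: "y \<in> U"
  shows "flux w S \<gamma> s a (\<psi> y) =
    D y powr (w - 1) * (\<Sum>c\<in>UNIV. jacobian \<psi> y $ a $ c * flux w S' \<gamma>' s' c y)"
proof -
  let ?u = "\<lambda>b. covariant_partial w \<gamma> b s (\<psi> y)" and ?J = "\<lambda>a b. jacobian \<psi> y $ a $ b"
  have powr: "D y powr (w - 1) * D y powr w = D y powr (- \<delta>)"
    by (simp add: w field_simps flip: powr_add)
  have "D y powr (w - 1) * (\<Sum>c\<in>UNIV. ?J a c * flux w S' \<gamma>' s' c y)
      = (D y powr (w - 1) * D y powr w) *
        (\<Sum>c\<in>UNIV. \<Sum>d\<in>UNIV. \<Sum>b\<in>UNIV. ?J a c * ?J b d * S' y $ c $ d * ?u b)"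
    unfolding flux_def covariant_partial_transform[OF y]
    by (simp add: sum_distrib_left mult_ac)
  also have "(\<Sum>c\<in>UNIV. \<Sum>d\<in>UNIV. \<Sum>b\<in>UNIV. ?J a c * ?J b d * S' y $ c $ d * ?u b)
      = (\<Sum>b\<in>UNIV. \<Sum>c\<in>UNIV. \<Sum>d\<in>UNIV. ?J a c * ?J b d * S' y $ c $ d * ?u b)"
    by (subst (2) sum.swap, subst sum.swap) (rule refl)
  also have "(D y powr (w - 1) * D y powr w) * \<dots> = flux w S \<gamma> s a (\<psi> y)"
    unfolding powr flux_def S[OF y] by (simp add: sum_distrib_left sum_distrib_right mult_ac)
  finally show ?thesis by simp
qed

text \<open>For the flux the exponent is \<open>r = w - 1\<close>, so its divergence acquires
  \<open>w\<close> times the \<open>dlog\<close> sum. The connection term of the divergence form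
  acquires the same sum with the opposite sign; this balance depends on the choice of
  \<open>w\<close>.\<close>

lemma sing_op_transform:
  assumes y: "y \<in> U"
  shows "sing_op \<delta> S' \<gamma>' s' y = sing_op \<delta> S \<gamma> s (\<psi> y) * \<bar>D y\<bar> powr (1 - w)"
proof -
  let ?f = "flux w S \<gamma> s" and ?f' = "flux w S' \<gamma>' s'"
  have d: "?f a differentiable (at (\<psi> y))" "?f' a differentiable (at y)" for a
    using smooth_on_imp_differentiable smooth_on_flux[OF open_V smooth] smooth_on_flux[OF open_U smooth']
      \<psi>_in y by blast+
  have div: "(\<Sum>a\<in>UNIV. partial a (?f a) (\<psi> y)) =
      D y powr (w - 1) * ((\<Sum>c\<in>UNIV. partial c (?f' c) y) + w * (\<Sum>c\<in>UNIV. dlog c y * ?f' c y))"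
    using divergence_transform[OF y d flux_transform] by simp
  have "(\<Sum>a\<in>UNIV. \<gamma> (\<psi> y) $ a * ?f a (\<psi> y)) =
      D y powr (w - 1) * (\<Sum>a\<in>UNIV. \<Sum>c\<in>UNIV. jacobian \<psi> y $ a $ c * \<gamma> (\<psi> y) $ a * ?f' c y)"
    by (simp add: flux_transform[OF y] sum_distrib_left mult_ac)
  also have "(\<Sum>a\<in>UNIV. \<Sum>c\<in>UNIV. jacobian \<psi> y $ a $ c * \<gamma> (\<psi> y) $ a * ?f' c y)
      = (\<Sum>c\<in>UNIV. (\<gamma>' y $ c + dlog c y) * ?f' c y)"
    by (subst sum.swap) (simp add: connection_transform[OF y] sum_distrib_right)
  finally have "sing_op \<delta> S \<gamma> s (\<psi> y) = D y powr (w - 1) * sing_op \<delta> S' \<gamma>' s' y"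
    unfolding sing_op_divergence_form[OF open_U y smooth' symmetric'[OF y] w]
      sing_op_divergence_form[OF open_V \<psi>_in[OF y] smooth symmetric[OF \<psi>_in[OF y]] w] div
    by (simp add: sum.distrib algebra_simps)
  \<comment> \<open>Moves the power of \<open>D\<close> to the other side, where it is the
    transformation factor of a density of weight \<open>1 - w\<close>.\<close>
  moreover have "D y powr (w - 1) * D y powr (1 - w) = 1"
    using det_pos[OF y] by (simp flip: powr_add)
  ultimately show ?thesis
    using det_pos[OF y] by (simp add: mult.commute mult.left_commute)
qed

end

end

section \<open>The operator on the manifold\<close>

lemma chart_inj_on:
  assumes "is_chart M c"
  shows "inj_on (snd c) (fst c)"
proof -
  have "topspace (subtopology M (fst c)) = fst c"
    using assms openin_subset unfolding is_chart_def by (fastforce simp: topspace_subtopology)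
  then show ?thesis
    using assms homeomorphic_imp_injective_map unfolding is_chart_def by metis
qed

lemma transition_chart:
  "inj_on (snd c) (fst c) \<Longrightarrow> p \<in> fst c \<Longrightarrow> transition c c' (snd c p) = snd c' p"
  by (simp add: transition_def inv_into_f_f)

text \<open>A chart is a homeomorphism onto an open set, so the image of an open part of its domain
  is open in the whole space.\<close>

lemma open_chart_overlap:
  assumes "is_chart M c" "is_chart M c'"
  shows "open (chart_overlap c c')"
proof -
  have "openin (subtopology M (fst c)) (fst c \<inter> fst c')"
    using assms by (simp add: is_chart_def openin_subtopology_Int2)
  moreover have "fst c \<inter> fst c' \<subseteq> topspace (subtopology M (fst c))"
    using calculation openin_subset by blast
  ultimately have "openin (top_of_set (chart_image c)) (chart_overlap c c')"
    using assms(1) homeomorphic_map_openness unfolding is_chart_def chart_overlap_def by blast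
  then show ?thesis
    using assms(1) openin_open_eq unfolding is_chart_def by blast
qed

lemma chart_overlap_subset: "chart_overlap c c' \<subseteq> chart_image c"
  by (auto simp: chart_overlap_def chart_image_def)

text \<open>The overlap is seen in the coordinates of \<open>c'\<close> as \<open>U\<close> and in
  those of \<open>c\<close> as \<open>V\<close>. Orientation of the atlas enters here, as positivity
  of the Jacobian determinant.\<close>

lemma coordinate_change_transition:
  assumes M: "smooth_manifold M A" and or: "oriented_atlas A" and c: "c \<in> A" "c' \<in> A"
  shows "coordinate_change (chart_overlap c' c) (chart_overlap c c') (transition c' c) (transition c c')"
proof
  have charts: "is_chart M c" "is_chart M c'"
    using M c by (simp_all add: smooth_manifold_def)
  show "open (chart_overlap c' c)" "open (chart_overlap c c')"
    using charts by (simp_all add: open_chart_overlap)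
  note t = transition_chart[OF chart_inj_on[OF charts(1)]] transition_chart[OF chart_inj_on[OF charts(2)]]
  show "transition c' c y \<in> chart_overlap c c'" "transition c c' (transition c' c y) = y"
    if "y \<in> chart_overlap c' c" for y
    using that by (auto simp: chart_overlap_def t)
  show "transition c c' x \<in> chart_overlap c' c" "transition c' c (transition c c' x) = x"
    if "x \<in> chart_overlap c c'" for x
    using that by (auto simp: chart_overlap_def t)
  show "smooth_on (chart_overlap c' c) (transition c' c)" "smooth_on (chart_overlap c c') (transition c c')"
    using M c by (simp_all add: smooth_manifold_def)
  show "0 < det (jacobian (transition c' c) y)" if "y \<in> chart_overlap c' c" for y
    using or c that by (simp add: oriented_atlas_def)
qed

lemma Delta_sing_eq_sing_op:
  "s \<in> densities A ((1 - \<delta>) / 2) \<Longrightarrow> c \<in> A \<Longrightarrow> x \<in> chart_image c \<Longrightarrow>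
    Delta_sing A \<delta> S \<gamma> s c x = sing_op \<delta> (S c) (\<gamma> c) (s c) x"
  by (simp add: Delta_sing_def sing_op_def raise_index_def)

lemma Delta_sing_undefined: "s \<notin> densities A ((1 - \<delta>) / 2) \<Longrightarrow> Delta_sing A \<delta> S \<gamma> s = undefined"
  by (simp add: Delta_sing_def)

lemma smooth_on_sing_op:
  assumes "open U" "smooth_on U S" "smooth_on U \<gamma>" "smooth_on U s"
  shows "smooth_on U (sing_op \<delta> S \<gamma> s)"
  unfolding sing_op_def[abs_def]
  by (intro smooth_on_sum smooth_on_mult smooth_on_add smooth_on_vec_nth smooth_on_partial
      smooth_on_const assms)

lemma Delta_sing_density:
  assumes M: "smooth_manifold M A" and or: "oriented_atlas A"
    and S: "S \<in> symmetric_tensor_densities A \<delta>" and \<gamma>: "\<gamma> \<in> connections A"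
    and s: "s \<in> densities A ((1 - \<delta>) / 2)"
  shows "Delta_sing A \<delta> S \<gamma> s \<in> densities A ((1 + \<delta>) / 2)"
proof -
  have open_image: "open (chart_image c)" if "c \<in> A" for c
    using M that by (simp add: smooth_manifold_def is_chart_def)
  have smooth: "smooth_on (chart_image c) (S c)" "smooth_on (chart_image c) (\<gamma> c)"
    "smooth_on (chart_image c) (s c)" if "c \<in> A" for c
    using S \<gamma> s that by (simp_all add: symmetric_tensor_densities_def connections_def densities_def)
  have symmetric: "S c x $ a $ b = S c x $ b $ a" if "c \<in> A" "x \<in> chart_image c" for c x a b
    using S that by (simp add: symmetric_tensor_densities_def)
  have "supported_on_charts A (Delta_sing A \<delta> S \<gamma> s)"
    using s by (auto simp: supported_on_charts_def Delta_sing_def)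
  moreover have "smooth_on (chart_image c) (Delta_sing A \<delta> S \<gamma> s c)" if c: "c \<in> A" for c
    by (rule smooth_on_cong[OF open_image[OF c] smooth_on_sing_op[OF open_image[OF c] smooth[OF c]]])
      (use Delta_sing_eq_sing_op[OF s c] in simp)
  moreover have "Delta_sing A \<delta> S \<gamma> s c' y = Delta_sing A \<delta> S \<gamma> s c (transition c' c y) *
      \<bar>det (jacobian (transition c' c) y)\<bar> powr ((1 + \<delta>) / 2)"
    if c: "c \<in> A" "c' \<in> A" and y: "y \<in> chart_overlap c' c" for c c' y
  proof -
    \<comment> \<open>The components in \<open>c'\<close> take the part of the primed data, those in
      \<open>c\<close> of the unprimed data.\<close>
    interpret coordinate_change "chart_overlap c' c" "chart_overlap c c'"
      "transition c' c" "transition c c'"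
      by (rule coordinate_change_transition[OF M or c])
    note in_image = subsetD[OF chart_overlap_subset]
    have "sing_op \<delta> (S c') (\<gamma> c') (s c') y = sing_op \<delta> (S c) (\<gamma> c) (s c) (transition c' c y) *
        \<bar>det (jacobian (transition c' c) y)\<bar> powr (1 - (1 - \<delta>) / 2)"
    proof (rule sing_op_transform[OF refl _ _ _ _ _ _ _ _ _ _ _ y])
      show "smooth_on (chart_overlap c c') (S c)" "smooth_on (chart_overlap c c') (\<gamma> c)"
        "smooth_on (chart_overlap c c') (s c)" "smooth_on (chart_overlap c' c) (S c')"
        "smooth_on (chart_overlap c' c) (\<gamma> c')" "smooth_on (chart_overlap c' c) (s c')"
        using smooth c smooth_on_subset[OF _ chart_overlap_subset] by blast+
      show "S c x $ a $ b = S c x $ b $ a" if "x \<in> chart_overlap c c'" for x a b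
        by (rule symmetric[OF c(1) in_image[OF that]])
      show "S c' z $ a $ b = S c' z $ b $ a" if "z \<in> chart_overlap c' c" for z a b
        by (rule symmetric[OF c(2) in_image[OF that]])
    qed (use c S \<gamma> s in
        \<open>simp_all add: symmetric_tensor_densities_def connections_def densities_def\<close>)
    moreover have "1 - (1 - \<delta>) / 2 = (1 + \<delta>) / 2" by (simp add: field_simps)
    ultimately show ?thesis
      using Delta_sing_eq_sing_op[OF s] c in_image[OF y] in_image[OF \<psi>_in[OF y]] by simp
  qed
  ultimately show ?thesis by (simp add: densities_def)
qed

lemma operator_form_Delta_sing:
  assumes "c \<in> A"
  shows "operator_form A ((1 - \<delta>) / 2) c (S c) (\<lambda>x. \<chi> a. \<Sum>b\<in>UNIV. partial b (\<lambda>y. S c y $ b $ a) x)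
    (\<lambda>x. (1 - \<delta>) / 2 * ((\<Sum>a\<in>UNIV. partial a (\<lambda>y. raise_index S \<gamma> c y $ a) x)
        + (\<delta> - 1) / 2 * (\<Sum>a\<in>UNIV. \<gamma> c x $ a * raise_index S \<gamma> c x $ a)))
    (Delta_sing A \<delta> S \<gamma>)"
  using assms by (simp add: operator_form_def Delta_sing_def)

lemma has_principal_symbol_Delta_sing:
  assumes M: "smooth_manifold M A" and S: "S \<in> symmetric_tensor_densities A \<delta>"
    and \<gamma>: "\<gamma> \<in> connections A"
  shows "has_principal_symbol A ((1 - \<delta>) / 2) (Delta_sing A \<delta> S \<gamma>) S"
  unfolding has_principal_symbol_def
proof
  fix c assume c: "c \<in> A"
  have U: "open (chart_image c)"
    and smooth: "smooth_on (chart_image c) (S c)" "smooth_on (chart_image c) (\<gamma> c)"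
    using M S \<gamma> c
    by (simp_all add: smooth_manifold_def is_chart_def symmetric_tensor_densities_def connections_def)
  have raise: "smooth_on (chart_image c) (raise_index S \<gamma> c)"
    unfolding raise_index_def[abs_def]
    by (intro smooth_on_vec_lambda smooth_on_sum smooth_on_mult smooth_on_vec_nth U smooth)
  show "\<exists>T R. smooth_on (chart_image c) T \<and> smooth_on (chart_image c) R \<and>
      operator_form A ((1 - \<delta>) / 2) c (S c) T R (Delta_sing A \<delta> S \<gamma>)"
    \<comment> \<open>The operator form is resolved first because it determines \<open>T\<close> and
      \<open>R\<close>; their smoothness is checked afterwards.\<close>
    by (intro exI conjI, rule_tac[3] operator_form_Delta_sing[OF c])
      (intro smooth_on_vec_lambda smooth_on_sum smooth_on_mult smooth_on_add smooth_on_vec_nth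
        smooth_on_partial smooth_on_const U smooth raise)+
qed

lemma Delta_sing_second_order:
  assumes M: "smooth_manifold M A" and or: "oriented_atlas A"
    and S: "S \<in> symmetric_tensor_densities A \<delta>" and \<gamma>: "\<gamma> \<in> connections A"
  shows "Delta_sing A \<delta> S \<gamma> \<in> second_order_operators A ((1 - \<delta>) / 2) \<delta>"
proof -
  have "(1 - \<delta>) / 2 + \<delta> = (1 + \<delta>) / 2" by (simp add: field_simps)
  then have "Delta_sing A \<delta> S \<gamma> \<in> densities A ((1 - \<delta>) / 2) \<rightarrow>\<^sub>E densities A ((1 - \<delta>) / 2 + \<delta>)"
    using Delta_sing_density[OF assms] Delta_sing_undefined by (metis PiE_I)
  moreover have "\<forall>c\<in>A. smooth_on (chart_image c) (S c)"
    using S by (simp add: symmetric_tensor_densities_def)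
  ultimately show ?thesis
    using has_principal_symbol_Delta_sing[OF M S \<gamma>]
    unfolding second_order_operators_def has_principal_symbol_def by blast
qed

section \<open>The groupoid\<close>

text \<open>Both connections carry the same logarithmic term, so it drops out of the difference and
  a homogeneous law remains.\<close>

lemma connection_difference_covector:
  assumes M: "smooth_manifold M A" and \<gamma>: "\<gamma> \<in> connections A" "\<gamma>' \<in> connections A"
  shows "(\<lambda>c x. \<gamma>' c x - \<gamma> c x) \<in> covector_fields A"
  using assms unfolding covector_fields_def connections_def
  by (auto simp: supported_on_charts_def smooth_manifold_def is_chart_def algebra_simps
      sum.distrib sum_subtractf intro: smooth_on_diff)

text \<open>An arrow is fixed by its ends, since its label is their difference; labels telescope
  under composition. Closure under composition and inverse is transitivity and symmetry of equality
  of operators.\<close>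

lemma groupoid_connections:
  "groupoid (connections A) (connection_arrows A \<delta> S) arrow_source arrow_target
    arrow_comp arrow_ident arrow_inverse"
  by unfold_locales
    (auto simp: connection_arrows_def arrow_source_def arrow_target_def arrow_comp_def
      arrow_ident_def arrow_inverse_def)

lemma connection_orbit_iff:
  "\<gamma>' \<in> connection_orbit A \<delta> S \<gamma> \<longleftrightarrow>
    \<gamma> \<in> connections A \<and> \<gamma>' \<in> connections A \<and> Delta_sing A \<delta> S \<gamma>' = Delta_sing A \<delta> S \<gamma>"
  by (auto simp: connection_orbit_def connection_arrows_def)

lemma equiv_connection_orbit:
  "equiv (connections A) {(\<gamma>, \<gamma>'). \<gamma> \<in> connections A \<and> \<gamma>' \<in> connection_orbit A \<delta> S \<gamma>}"
  by (rule equivI) (auto simp: refl_on_def sym_def trans_def connection_orbit_iff)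

text \<open>The operator is constant on the orbit, and the orbit contains \<gamma> itself, so the
  description has exactly one solution.\<close>

lemma Delta_orbit_eq:
  "\<gamma> \<in> connections A \<Longrightarrow> Delta_orbit A \<delta> S (connection_orbit A \<delta> S \<gamma>) = Delta_sing A \<delta> S \<gamma>"
  unfolding Delta_orbit_def by (rule the_equality) (auto simp: connection_orbit_iff)

theorem proposition5:
  fixes M :: "'a topology"
    and A :: "('a, 'n::finite) chart set"
    and \<delta> :: real
    and S :: "('a, 'n) chart \<Rightarrow> real^'n \<Rightarrow> real^'n^'n"
  assumes "smooth_manifold M A"
    and "compact_space M"
    and "oriented_atlas A"
    and "S \<in> symmetric_tensor_densities A \<delta>"
  shows
    "groupoid (connections A) (connection_arrows A \<delta> S) arrow_source arrow_target
       arrow_comp arrow_ident arrow_inverse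
     \<and> (\<forall>(\<gamma>, X, \<gamma>') \<in> connection_arrows A \<delta> S. X \<in> covector_fields A)
     \<and> equiv (connections A)
         {(\<gamma>, \<gamma>'). \<gamma> \<in> connections A \<and> \<gamma>' \<in> connection_orbit A \<delta> S \<gamma>}
     \<and> (\<forall>\<gamma>\<in>connections A.
          Delta_orbit A \<delta> S (connection_orbit A \<delta> S \<gamma>) = Delta_sing A \<delta> S \<gamma>
          \<and> Delta_sing A \<delta> S \<gamma> \<in>
              densities A ((1 - \<delta>) / 2) \<rightarrow>\<^sub>E densities A ((1 + \<delta>) / 2)
          \<and> Delta_sing A \<delta> S \<gamma> \<in> second_order_operators A ((1 - \<delta>) / 2) \<delta>
          \<and> has_principal_symbol A ((1 - \<delta>) / 2) (Delta_sing A \<delta> S \<gamma>) S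
          \<and> (\<forall>\<gamma>'\<in>connection_orbit A \<delta> S \<gamma>. Delta_sing A \<delta> S \<gamma>' = Delta_sing A \<delta> S \<gamma>))"
proof (intro conjI ballI)
  show "groupoid (connections A) (connection_arrows A \<delta> S) arrow_source arrow_target
      arrow_comp arrow_ident arrow_inverse"
    by (rule groupoid_connections)
  show "case arrow of (\<gamma>, X, \<gamma>') \<Rightarrow> X \<in> covector_fields A"
    if "arrow \<in> connection_arrows A \<delta> S" for arrow
    using that connection_difference_covector[OF assms(1)] by (auto simp: connection_arrows_def)
  show "equiv (connections A) {(\<gamma>, \<gamma>'). \<gamma> \<in> connections A \<and> \<gamma>' \<in> connection_orbit A \<delta> S \<gamma>}"
    by (rule equiv_connection_orbit)
  fix \<gamma> assume \<gamma>: "\<gamma> \<in> connections A"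
  show "Delta_orbit A \<delta> S (connection_orbit A \<delta> S \<gamma>) = Delta_sing A \<delta> S \<gamma>"
    by (rule Delta_orbit_eq[OF \<gamma>])
  show "Delta_sing A \<delta> S \<gamma> \<in> densities A ((1 - \<delta>) / 2) \<rightarrow>\<^sub>E densities A ((1 + \<delta>) / 2)"
    using Delta_sing_density[OF assms(1,3,4) \<gamma>] Delta_sing_undefined by (metis PiE_I)
  show "Delta_sing A \<delta> S \<gamma> \<in> second_order_operators A ((1 - \<delta>) / 2) \<delta>"
    by (rule Delta_sing_second_order[OF assms(1,3,4) \<gamma>])
  show "has_principal_symbol A ((1 - \<delta>) / 2) (Delta_sing A \<delta> S \<gamma>) S"
    by (rule has_principal_symbol_Delta_sing[OF assms(1,4) \<gamma>])
  show "Delta_sing A \<delta> S \<gamma>' = Delta_sing A \<delta> S \<gamma>" if "\<gamma>' \<in> connection_orbit A \<delta> S \<gamma>" for \<gamma>'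
    using that by (simp add: connection_orbit_iff)
qed

end
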